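(* Let $A:\Omega\to\mathcal{L}(H)$ be a random operator with moment kernel $K(m,n):=\mathbb{E}[A^{*m}A^n]$, $m,n\in\mathbb{N}_0$, and set $K_{shift}(m,n):=K(m+1,n+1)$ for all $m,n\in\mathbb{N}_0$. The following are equivalent: (1) There exists a moment dilation $(\mathcal{K},U,P,W)$ of $A$, so that $$K(m,n)=W^*U^{*m}PU^nW,\qquad m,n\in\mathbb{N}_0,$$ which satisfies $$U^*PU\le P\quad\text{on }\ \overline{\mathrm{span}}\{U^kWH:k\in\mathbb{N}_0\}.$$ (2) $K_{shift}\le K$, i.e. $K-K_{shift}$ is positive definite. In particular, if $K_{shift}\le K$, then $A$ admits a moment dilation $(\mathcal{K},U,P,W)$ subject to the constraint $U^*PU\le P$ on $\overline{\mathrm{span}}\{U^kWH:k\in\mathbb{N}_0\}$.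
   Context: Hilbert spaces are complex, with inner products linear in the second variable; $\mathcal{L}(H)$ denotes the bounded linear operators on $H$; $\mathbb{N}_0=\{0,1,2,\dots\}$. $(\Omega,\mathbb{P})$ is a Borel probability space and $H$ is a Hilbert space. A random operator is a strongly measurable map $A:\Omega\to\mathcal{L}(H)$ (i.e. $\omega\mapsto A(\omega)a$ is strongly measurable for each $a\in H$). It is understood that the moments exist: $\mathbb{E}[\|A^na\|^2]<\infty$ for all $n\in\mathbb{N}_0$, $a\in H$, and $\mathbb{E}[A^{*m}A^n]\in\mathcal{L}(H)$ is defined weakly by $\langle a,\mathbb{E}[A^{*m}A^n]b\rangle=\mathbb{E}[\langle A^ma,A^nb\rangle]$ for $a,b\in H$. A moment dilation of $A$ is a tuple $(\mathcal{K},U,P,W)$ consisting of a Hilbert space $\mathcal{K}$, a unitary $U\in\mathcal{L}(\mathcal{K})$, a selfadjoint projection $P\in\mathcal{L}(\mathcal{K})$ and an isometry $W:H\to\mathcal{K}$ such that $\mathbb{E}[A^{*m}A^n]=W^*U^{*m}PU^nW$ for all $m,n\in\mathbb{N}_0$. For a closed subspace $\mathcal{M}\subset\mathcal{K}$, "$U^*PU\le P$ on $\mathcal{M}$" means $\langle y,U^*PUy\rangle\le\langle y,Py\rangle$ for all $y\in\mathcal{M}$. A kernel $L:\mathbb{N}_0\times\mathbb{N}_0\to\mathcal{L}(H)$ is positive definite if $\sum_{i,j}\langle a_i,L(m_i,m_j)a_j\rangle\ge0$ for all finite families $\{(m_i,a_i)\}$ in $\mathbb{N}_0\times H$. *)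

theory Defs
  imports
    "HOL-Probability.Probability"
    "HOL-Library.Complex_Order"
    "HOL-Library.Function_Algebras"
begin

(* Hilbert spaces are carrier based: the carrier is a linear subspace of an ambient complex vector
   space, whose addition is that of the type and whose scalar multiplication is part of the
   structure.  The inner product matters only on the carrier. *)
record 'a hilbert =
  hcarrier :: "'a set"
  hscale :: "complex \<Rightarrow> 'a \<Rightarrow> 'a"
  hinner :: "'a \<Rightarrow> 'a \<Rightarrow> complex"

definition hnorm :: "'a hilbert \<Rightarrow> 'a \<Rightarrow> real" where
  "hnorm V x = sqrt (Re (hinner V x x))"

(* The value 0 off the carrier makes this a distance function in the sense of the locale
   Metric_space, which asks for symmetry and nonnegativity on the whole type. *)
definition hdist :: "'a::ab_group_add hilbert \<Rightarrow> 'a \<Rightarrow> 'a \<Rightarrow> real" where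
  "hdist V x y = (if x \<in> hcarrier V \<and> y \<in> hcarrier V then hnorm V (x - y) else 0)"

definition htopology :: "'a::ab_group_add hilbert \<Rightarrow> 'a topology" where
  "htopology V = Metric_space.mtopology (hcarrier V) (hdist V)"

locale complex_inner_product_space = vector_space "hscale V"
  for V :: "'a::ab_group_add hilbert" +
  assumes subspace_carrier: "subspace (hcarrier V)"
    and hinner_commute:
      "\<And>x y. \<lbrakk>x \<in> hcarrier V; y \<in> hcarrier V\<rbrakk> \<Longrightarrow> hinner V x y = cnj (hinner V y x)"
    and hinner_add_right:
      "\<And>x y z. \<lbrakk>x \<in> hcarrier V; y \<in> hcarrier V; z \<in> hcarrier V\<rbrakk>
        \<Longrightarrow> hinner V x (y + z) = hinner V x y + hinner V x z"
    and hinner_scale_right: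
      "\<And>c x y. \<lbrakk>x \<in> hcarrier V; y \<in> hcarrier V\<rbrakk>
        \<Longrightarrow> hinner V x (hscale V c y) = c * hinner V x y"
    and hinner_nonneg: "\<And>x. x \<in> hcarrier V \<Longrightarrow> 0 \<le> hinner V x x"
    and hinner_eq_zero: "\<And>x. \<lbrakk>x \<in> hcarrier V; hinner V x x = 0\<rbrakk> \<Longrightarrow> x = 0"

locale complex_hilbert_space = complex_inner_product_space +
  assumes complete: "Metric_space.mcomplete (hcarrier V) (hdist V)"

context complex_inner_product_space
begin

lemma hinner_add_left:
  assumes "x \<in> hcarrier V" "y \<in> hcarrier V" "z \<in> hcarrier V"
  shows "hinner V (x + y) z = hinner V x z + hinner V y z"
  using assms subspace_add[OF subspace_carrier]
  by (metis complex_cnj_add hinner_add_right hinner_commute)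

lemma hinner_scale_left:
  assumes "x \<in> hcarrier V" "y \<in> hcarrier V"
  shows "hinner V (hscale V c x) y = cnj c * hinner V x y"
  using assms subspace_scale[OF subspace_carrier]
  by (metis complex_cnj_mult hinner_scale_right hinner_commute)

lemma hnorm_power2: "x \<in> hcarrier V \<Longrightarrow> (hnorm V x)\<^sup>2 = Re (hinner V x x)"
  using hinner_nonneg[of x] by (simp add: hnorm_def less_eq_complex_def)

lemma hnorm_nonneg: "x \<in> hcarrier V \<Longrightarrow> 0 \<le> hnorm V x"
  using hinner_nonneg[of x] by (simp add: hnorm_def less_eq_complex_def)

lemma hinner_zero_right: "x \<in> hcarrier V \<Longrightarrow> hinner V x 0 = 0"
  using hinner_scale_right[of x x 0] by simp

lemma Re_hinner_le:
  assumes x: "x \<in> hcarrier V" and y: "y \<in> hcarrier V"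
  shows "Re (hinner V x y) \<le> hnorm V x * hnorm V y"
proof -
  have key: "0 \<le> t\<^sup>2 * (hnorm V x)\<^sup>2 - 2 * t * s * Re (hinner V x y) + s\<^sup>2 * (hnorm V y)\<^sup>2"
    for t s :: real
  proof -
    let ?u = "hscale V (of_real t) x" and ?v = "hscale V (of_real (- s)) y"
    have u: "?u \<in> hcarrier V" and v: "?v \<in> hcarrier V"
      using subspace_scale[OF subspace_carrier x] subspace_scale[OF subspace_carrier y] by blast+
    have w: "?u + ?v \<in> hcarrier V" using u v subspace_add[OF subspace_carrier] by blast
    have yx: "Re (hinner V y x) = Re (hinner V x y)"
      using hinner_commute[OF y x] by simp
    have "0 \<le> Re (hinner V (?u + ?v) (?u + ?v))"
      using hinner_nonneg[OF w] by (simp add: less_eq_complex_def)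
    also have "hinner V (?u + ?v) (?u + ?v) = of_real (t\<^sup>2) * hinner V x x
        - of_real (t * s) * (hinner V x y + hinner V y x) + of_real (s\<^sup>2) * hinner V y y"
      unfolding hinner_add_left[OF u v w] hinner_add_right[OF u u v] hinner_add_right[OF v u v]
        hinner_scale_left[OF x u] hinner_scale_left[OF x v]
        hinner_scale_left[OF y u] hinner_scale_left[OF y v]
        hinner_scale_right[OF x x] hinner_scale_right[OF x y]
        hinner_scale_right[OF y x] hinner_scale_right[OF y y]
      by (simp add: algebra_simps power2_eq_square)
    finally show ?thesis
      using yx by (simp add: hnorm_power2[OF x] hnorm_power2[OF y] algebra_simps)
  qed
  let ?p = "hnorm V x" and ?q = "hnorm V y" and ?r = "Re (hinner V x y)"
  have p: "0 \<le> ?p" and q: "0 \<le> ?q" using x y hnorm_nonneg by auto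
  show ?thesis
  proof (cases "?p = 0 \<or> ?q = 0")
    case True
    have zero: "z = 0" if "z \<in> hcarrier V" "hnorm V z = 0" for z
    proof -
      have "Re (hinner V z z) = 0" using hnorm_power2[OF that(1)] that(2) by simp
      then have "hinner V z z = 0"
        using hinner_nonneg[OF that(1)] by (simp add: less_eq_complex_def complex_eq_iff)
      then show ?thesis using hinner_eq_zero that(1) by blast
    qed
    have "hinner V x y = 0"
      using True
    proof
      assume "?p = 0"
      then show ?thesis
        using zero[OF x] hinner_zero_right[OF y] hinner_commute[OF x y] by simp
    next
      assume "?q = 0"
      then show ?thesis using zero[OF y] hinner_zero_right[OF x] by simp
    qed
    then show ?thesis using p q by simp
  next
    case False
    then have pq: "0 < ?p * ?q" using p q by auto
    have "0 \<le> 2 * (?p * ?q) * (?p * ?q - ?r)"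
      using key[of ?q ?p] by (simp add: algebra_simps power2_eq_square)
    then show ?thesis using pq by (simp add: zero_le_mult_iff)
  qed
qed

lemma hnorm_triangle:
  assumes x: "x \<in> hcarrier V" and y: "y \<in> hcarrier V"
  shows "hnorm V (x + y) \<le> hnorm V x + hnorm V y"
proof (rule power2_le_imp_le)
  have xy: "x + y \<in> hcarrier V" using x y subspace_add[OF subspace_carrier] by blast
  have "(hnorm V (x + y))\<^sup>2 = (hnorm V x)\<^sup>2 + 2 * Re (hinner V x y) + (hnorm V y)\<^sup>2"
    unfolding hnorm_power2[OF xy] hnorm_power2[OF x] hnorm_power2[OF y]
      hinner_add_left[OF x y xy] hinner_add_right[OF x x y] hinner_add_right[OF y x y]
    using hinner_commute[OF y x] by simp
  also have "\<dots> \<le> (hnorm V x + hnorm V y)\<^sup>2"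
    using Re_hinner_le[OF x y] by (simp add: power2_sum)
  finally show "(hnorm V (x + y))\<^sup>2 \<le> (hnorm V x + hnorm V y)\<^sup>2" .
  show "0 \<le> hnorm V x + hnorm V y" using x y hnorm_nonneg by simp
qed

lemma Metric_space_hdist: "Metric_space (hcarrier V) (hdist V)"
proof
  note diff = subspace_diff[OF subspace_carrier]
  show "0 \<le> hdist V x y" for x y
    by (simp add: hdist_def hnorm_nonneg diff)
  show "hdist V x y = hdist V y x" for x y
  proof (cases "x \<in> hcarrier V \<and> y \<in> hcarrier V")
    case True
    then have d: "x - y \<in> hcarrier V" using diff by blast
    have e: "hscale V (-1) (x - y) = y - x" by simp
    have "hinner V (y - x) (y - x) = hinner V (x - y) (x - y)"
      using hinner_scale_left[OF d, of "hscale V (-1) (x - y)" "-1"]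
        hinner_scale_right[OF d d, of "-1"] subspace_scale[OF subspace_carrier d, of "-1"]
      unfolding e by simp
    then show ?thesis by (simp add: hdist_def hnorm_def)
  qed (auto simp: hdist_def)
  show "hdist V x y = 0 \<longleftrightarrow> x = y" if "x \<in> hcarrier V" "y \<in> hcarrier V" for x y
  proof -
    have d: "x - y \<in> hcarrier V" using that diff by blast
    have "hnorm V (x - y) = 0 \<longleftrightarrow> hinner V (x - y) (x - y) = 0"
      using hinner_nonneg[OF d] by (simp add: hnorm_def less_eq_complex_def complex_eq_iff)
    also have "\<dots> \<longleftrightarrow> x - y = 0"
      using hinner_eq_zero[OF d] hinner_zero_right[OF d] by auto
    finally show ?thesis using that by (simp add: hdist_def)
  qed
  show "hdist V x z \<le> hdist V x y + hdist V y z"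
    if "x \<in> hcarrier V" "y \<in> hcarrier V" "z \<in> hcarrier V" for x y z
    using hnorm_triangle[of "x - y" "y - z"] that by (simp add: hdist_def diff)
qed

end

definition bounded_operator ::
  "'a::ab_group_add hilbert \<Rightarrow> 'b::ab_group_add hilbert \<Rightarrow> ('a \<Rightarrow> 'b) \<Rightarrow> bool" where
  "bounded_operator V W T \<longleftrightarrow>
     T \<in> hcarrier V \<rightarrow> hcarrier W \<and>
     (\<forall>x\<in>hcarrier V. \<forall>y\<in>hcarrier V. T (x + y) = T x + T y) \<and>
     (\<forall>c. \<forall>x\<in>hcarrier V. T (hscale V c x) = hscale W c (T x)) \<and>
     (\<exists>B. \<forall>x\<in>hcarrier V. hnorm W (T x) \<le> B * hnorm V x)"

(* Off the carrier of W the value is meaningless; operators are only ever compared on carriers. *)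
definition hadjoint :: "'a hilbert \<Rightarrow> 'b hilbert \<Rightarrow> ('a \<Rightarrow> 'b) \<Rightarrow> 'b \<Rightarrow> 'a" where
  "hadjoint V W T y =
     (THE x. x \<in> hcarrier V \<and> (\<forall>z\<in>hcarrier V. hinner V z x = hinner W (T z) y))"

definition unitary_operator :: "'a::ab_group_add hilbert \<Rightarrow> ('a \<Rightarrow> 'a) \<Rightarrow> bool" where
  "unitary_operator V U \<longleftrightarrow> bounded_operator V V U \<and>
     (\<forall>x\<in>hcarrier V. hadjoint V V U (U x) = x \<and> U (hadjoint V V U x) = x)"

definition selfadjoint_projection :: "'a::ab_group_add hilbert \<Rightarrow> ('a \<Rightarrow> 'a) \<Rightarrow> bool" where
  "selfadjoint_projection V P \<longleftrightarrow> bounded_operator V V P \<and>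
     (\<forall>x\<in>hcarrier V. P (P x) = P x \<and> hadjoint V V P x = P x)"

definition isometry_operator ::
  "'a::ab_group_add hilbert \<Rightarrow> 'b::ab_group_add hilbert \<Rightarrow> ('a \<Rightarrow> 'b) \<Rightarrow> bool" where
  "isometry_operator V W T \<longleftrightarrow> bounded_operator V W T \<and>
     (\<forall>x\<in>hcarrier V. hnorm W (T x) = hnorm V x)"

definition borel_prob_space :: "'w::topological_space measure \<Rightarrow> bool" where
  "borel_prob_space M \<longleftrightarrow> prob_space M \<and> sets M = sets borel"

(* On a nonseparable space this is stronger than Borel measurability. *)
definition strongly_measurable ::
  "'w measure \<Rightarrow> 'h::ab_group_add hilbert \<Rightarrow> ('w \<Rightarrow> 'h) \<Rightarrow> bool" where
  "strongly_measurable M H f \<longleftrightarrow>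
     (\<exists>s :: nat \<Rightarrow> 'w \<Rightarrow> 'h.
        (\<forall>i. simple_function M (s i) \<and> s i \<in> space M \<rightarrow> hcarrier H) \<and>
        (\<forall>\<omega>\<in>space M. limitin (htopology H) (\<lambda>i. s i \<omega>) (f \<omega>) sequentially))"

definition random_operator ::
  "'w measure \<Rightarrow> 'h::ab_group_add hilbert \<Rightarrow> ('w \<Rightarrow> 'h \<Rightarrow> 'h) \<Rightarrow> bool" where
  "random_operator M H A \<longleftrightarrow>
     (\<forall>\<omega>\<in>space M. bounded_operator H H (A \<omega>)) \<and>
     (\<forall>a\<in>hcarrier H. strongly_measurable M H (\<lambda>\<omega>. A \<omega> a))"

definition moments_exist ::
  "'w measure \<Rightarrow> 'h hilbert \<Rightarrow> ('w \<Rightarrow> 'h \<Rightarrow> 'h) \<Rightarrow> bool" where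
  "moments_exist M H A \<longleftrightarrow>
     (\<forall>n. \<forall>a\<in>hcarrier H. integrable M (\<lambda>\<omega>. (hnorm H ((A \<omega> ^^ n) a))\<^sup>2))"

(* The operator E[A*^m A^n], given by its values: the vector at b represents the functional
   a \<mapsto> E <A^m a, A^n b>. *)
definition moment_kernel ::
  "'w measure \<Rightarrow> 'h hilbert \<Rightarrow> ('w \<Rightarrow> 'h \<Rightarrow> 'h) \<Rightarrow> nat \<Rightarrow> nat \<Rightarrow> 'h \<Rightarrow> 'h" where
  "moment_kernel M H A m n b =
     (THE c. c \<in> hcarrier H \<and>
        (\<forall>a\<in>hcarrier H. hinner H a c = (LINT \<omega>|M. hinner H ((A \<omega> ^^ m) a) ((A \<omega> ^^ n) b))))"

definition shift_kernel :: "(nat \<Rightarrow> nat \<Rightarrow> 'h \<Rightarrow> 'h) \<Rightarrow> nat \<Rightarrow> nat \<Rightarrow> 'h \<Rightarrow> 'h" where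
  "shift_kernel L = (\<lambda>m n. L (m + 1) (n + 1))"

(* The order of type complex makes 0 \<le> z say that z is real and nonnegative. *)
definition positive_definite_kernel ::
  "'h::ab_group_add hilbert \<Rightarrow> (nat \<Rightarrow> nat \<Rightarrow> 'h \<Rightarrow> 'h) \<Rightarrow> bool" where
  "positive_definite_kernel H L \<longleftrightarrow>
     (\<forall>(N::nat) (m :: nat \<Rightarrow> nat) (a :: nat \<Rightarrow> 'h). (\<forall>i<N. a i \<in> hcarrier H) \<longrightarrow>
        0 \<le> (\<Sum>i<N. \<Sum>j<N. hinner H (a i) (L (m i) (m j) (a j))))"

definition kernel_le ::
  "'h::ab_group_add hilbert \<Rightarrow> (nat \<Rightarrow> nat \<Rightarrow> 'h \<Rightarrow> 'h) \<Rightarrow> (nat \<Rightarrow> nat \<Rightarrow> 'h \<Rightarrow> 'h) \<Rightarrow> bool" where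
  "kernel_le H L L' \<longleftrightarrow> positive_definite_kernel H (\<lambda>m n a. L' m n a - L m n a)"

definition moment_dilation ::
  "'w measure \<Rightarrow> 'h::ab_group_add hilbert \<Rightarrow> ('w \<Rightarrow> 'h \<Rightarrow> 'h) \<Rightarrow>
   'k::ab_group_add hilbert \<Rightarrow> ('k \<Rightarrow> 'k) \<Rightarrow> ('k \<Rightarrow> 'k) \<Rightarrow> ('h \<Rightarrow> 'k) \<Rightarrow> bool" where
  "moment_dilation M H A K U P W \<longleftrightarrow>
     complex_hilbert_space K \<and> unitary_operator K U \<and> selfadjoint_projection K P \<and>
     isometry_operator H K W \<and>
     (\<forall>m n. \<forall>a\<in>hcarrier H.
        moment_kernel M H A m n a =
        hadjoint H K W ((hadjoint K K U ^^ m) (P ((U ^^ n) (W a)))))"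

definition orbit_span ::
  "'h hilbert \<Rightarrow> 'k::ab_group_add hilbert \<Rightarrow> ('k \<Rightarrow> 'k) \<Rightarrow> ('h \<Rightarrow> 'k) \<Rightarrow> 'k set" where
  "orbit_span H K U W =
     htopology K closure_of
       module.span (hscale K) {(U ^^ k) (W a) | k a. a \<in> hcarrier H}"

definition operator_le_on ::
  "'k hilbert \<Rightarrow> 'k set \<Rightarrow> ('k \<Rightarrow> 'k) \<Rightarrow> ('k \<Rightarrow> 'k) \<Rightarrow> bool" where
  "operator_le_on K S T T' \<longleftrightarrow> (\<forall>y\<in>S. hinner K y (T y) \<le> hinner K y (T' y))"

(* HOL cannot quantify existentially over the type underlying a Hilbert space.  Every dilation that
   is asserted to exist lives on a space of functions of this type, which is large enough for the
   reproducing kernel Hilbert space spanned by vectors U^k T^n W a, where k is an integer, n a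
   natural number, a a vector of H, and T the contraction that U dilates. *)
type_synonym 'h dilation_vec = "int \<times> nat \<times> 'h \<Rightarrow> complex"

end

theory Submission
  imports Defs
begin

text \<open>
  A dilation \<open>(K, U, P, W)\<close> that satisfies the constraint gives the kernel inequality by testing the
  constraint on the vectors \<open>\<Sum>\<^sub>i U\<^sup>m\<^sup>i W a\<^sub>i\<close>: the quadratic form of the kernel \<open>(m, n) \<mapsto> E[A\<^sup>*\<^sup>m A\<^sup>n]\<close> is
  \<open>\<langle>y, P y\<rangle>\<close> there, and that of the shifted kernel is \<open>\<langle>y, U\<^sup>* P U y\<rangle>\<close> (\<open>dilation_imp_kernel_le\<close>).

  Conversely, let the shifted kernel be dominated.  In the square integrable random vectors, the
  random vectors \<open>A\<^sup>n a\<close> span a space on which \<open>T : A\<^sup>n a \<mapsto> A\<^sup>n\<^sup>+\<^sup>1 a\<close> is well defined and contractive; this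
  is what the kernel inequality says.  A unitary dilation \<open>U\<close> of \<open>T\<close>, with \<open>P\<close> the projection onto the
  space of \<open>T\<close>, satisfies \<open>P U\<^sup>n = T\<^sup>n\<close> on that space, hence it is a moment dilation, and
  \<open>\<parallel>P U y\<parallel> = \<parallel>T P y\<parallel> \<le> \<parallel>P y\<parallel>\<close> for \<open>y\<close> in the span of the vectors \<open>U\<^sup>k W a\<close> with \<open>k \<ge> 0\<close>.

  The dilation is written down at once, without \<open>T\<close> and its space, as a reproducing kernel Hilbert
  space of functions on the triples \<open>(p, n, a)\<close>, where the triple stands for the vector \<open>U\<^sup>p T\<^sup>n W a\<close>.
  Inner products of such vectors are moments, since \<open>U\<close> is unitary and compresses to \<open>T\<close>; this
  determines \<open>dilation_kernel\<close>.  In this model \<open>U\<close> is the translation in \<open>p\<close>, which is unitary because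
  the kernel is invariant under it, and \<open>P\<close> is the projection whose kernel is the set of functions
  that vanish at level \<open>p = 0\<close>.  The kernel inequality enters through the positivity of
  \<open>dilation_kernel\<close> (\<open>psd_dilation_kernel\<close>) and, once more, in the final estimate \<open>\<parallel>P U y\<parallel> \<le> \<parallel>P y\<parallel>\<close>.

  Two general facts are needed.  The operators \<open>E[A\<^sup>*\<^sup>m A\<^sup>n]\<close> exist because \<open>a \<mapsto> E \<parallel>A\<^sup>n a\<parallel>\<^sup>2\<close> is bounded on
  the unit ball, by Fatou's lemma and Baire's theorem (\<open>second_moment_bounded\<close>,
  \<open>moment_kernel_inner\<close>).  And the Hilbert space of a positive semidefinite kernel is obtained as the
  space of bounded functionals on the finitely supported families; its squared norm is a supremum
  for which the parallelogram law holds by a change of variables, and it is lower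
  semicontinuous under pointwise limits, which makes the space complete (\<open>weighted_parallelogram\<close>,
  \<open>rkhs_hilbert\<close>).
\<close>

section \<open>Inner products, convergence and completeness\<close>

context complex_inner_product_space
begin

lemmas carrier_add = subspace_add[OF subspace_carrier]
  and carrier_scale = subspace_scale[OF subspace_carrier]
  and carrier_diff = subspace_diff[OF subspace_carrier]
  and carrier_zero = subspace_0[OF subspace_carrier]
  and carrier_sum = subspace_sum[OF subspace_carrier]

lemma hinner_diff_right:
  assumes "x \<in> hcarrier V" "y \<in> hcarrier V" "z \<in> hcarrier V"
  shows "hinner V x (y - z) = hinner V x y - hinner V x z"
  using hinner_add_right[of x "y - z" z] assms carrier_diff by (simp add: algebra_simps)

lemma hinner_diff_left:
  assumes "x \<in> hcarrier V" "y \<in> hcarrier V" "z \<in> hcarrier V"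
  shows "hinner V (x - y) z = hinner V x z - hinner V y z"
  using hinner_add_left[of "x - y" y z] assms carrier_diff by (simp add: algebra_simps)

lemma hinner_sum_right:
  assumes "x \<in> hcarrier V" "\<And>i. i \<in> I \<Longrightarrow> f i \<in> hcarrier V"
  shows "hinner V x (\<Sum>i\<in>I. f i) = (\<Sum>i\<in>I. hinner V x (f i))"
  using assms(2)
proof (induction I rule: infinite_finite_induct)
  case (insert i I)
  then show ?case
    using hinner_add_right[OF assms(1), of "f i" "sum f I"] carrier_sum[of I f] by simp
qed (simp_all add: hinner_zero_right[OF assms(1)])

lemma hinner_sum_left:
  assumes "x \<in> hcarrier V" "\<And>i. i \<in> I \<Longrightarrow> f i \<in> hcarrier V"
  shows "hinner V (\<Sum>i\<in>I. f i) x = (\<Sum>i\<in>I. hinner V (f i) x)"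
proof -
  have "hinner V (\<Sum>i\<in>I. f i) x = cnj (\<Sum>i\<in>I. hinner V x (f i))"
    using hinner_commute[of "sum f I" x] hinner_sum_right[of x I f] carrier_sum[of I f] assms
    by presburger
  also have "\<dots> = (\<Sum>i\<in>I. hinner V (f i) x)"
    unfolding cnj_sum by (intro sum.cong refl hinner_commute[symmetric] assms)
  finally show ?thesis .
qed

lemma hinner_self: "x \<in> hcarrier V \<Longrightarrow> hinner V x x = of_real ((hnorm V x)\<^sup>2)"
  using hinner_nonneg[of x] hnorm_power2[of x] by (simp add: less_eq_complex_def complex_eq_iff)

lemma hnorm_eq_zero: "\<lbrakk>x \<in> hcarrier V; hnorm V x = 0\<rbrakk> \<Longrightarrow> x = 0"
  using hinner_self[of x] hinner_eq_zero by simp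

lemma hnorm_scale:
  assumes "x \<in> hcarrier V"
  shows "hnorm V (hscale V c x) = cmod c * hnorm V x"
proof -
  have "hinner V (hscale V c x) (hscale V c x) = of_real ((cmod c * hnorm V x)\<^sup>2)"
    using assms carrier_scale[OF assms, of c]
    by (simp add: hinner_scale_left hinner_scale_right hinner_self[OF assms] power_mult_distrib
        mult_ac) (simp add: complex_norm_square[symmetric] flip: of_real_power)
  then show ?thesis
    using hnorm_nonneg[OF assms] by (simp add: hnorm_def del: of_real_power of_real_mult)
qed

lemma hnorm_minus_commute:
  assumes "x \<in> hcarrier V" "y \<in> hcarrier V"
  shows "hnorm V (x - y) = hnorm V (y - x)"
  using hnorm_scale[of "y - x" "-1"] carrier_diff[OF assms(2,1)] by simp

lemma cmod_hinner_le:
  assumes x: "x \<in> hcarrier V" and y: "y \<in> hcarrier V"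
  shows "cmod (hinner V x y) \<le> hnorm V x * hnorm V y"
proof (cases "hinner V x y = 0")
  case True
  then show ?thesis using hnorm_nonneg x y by simp
next
  case False
  let ?u = "hinner V x y"
  \<comment> \<open>rotating y makes the inner product real, and then the bound on the real part applies\<close>
  let ?c = "cnj ?u / of_real (cmod ?u)"
  have "?c * ?u = of_real (cmod ?u)"
    using False by (simp add: complex_norm_square[symmetric] power2_eq_square mult.commute)
  then have "cmod ?u = Re (hinner V x (hscale V ?c y))"
    using hinner_scale_right[OF x y, of ?c] by (metis Re_complex_of_real)
  also have "\<dots> \<le> hnorm V x * hnorm V (hscale V ?c y)"
    using Re_hinner_le[OF x carrier_scale[OF y]] .
  also have "hnorm V (hscale V ?c y) = hnorm V y"
    using False hnorm_scale[OF y, of ?c] by (simp add: norm_divide)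
  finally show ?thesis .
qed

lemma hinner_ext:
  assumes "x \<in> hcarrier V" "y \<in> hcarrier V"
    and "\<And>z. z \<in> hcarrier V \<Longrightarrow> hinner V z x = hinner V z y"
  shows "x = y"
proof -
  have d: "x - y \<in> hcarrier V" using assms carrier_diff by blast
  then have "hinner V (x - y) (x - y) = 0"
    using assms(3)[OF d] assms(1,2) hinner_diff_right[OF d] by simp
  then show ?thesis using hinner_eq_zero[OF d] by simp
qed

lemma the_representative:
  assumes "x \<in> hcarrier V" "\<And>z. z \<in> hcarrier V \<Longrightarrow> hinner V z x = f z"
  shows "(THE x. x \<in> hcarrier V \<and> (\<forall>z\<in>hcarrier V. hinner V z x = f z)) = x"
  using assms by (intro the_equality) (auto intro: hinner_ext)

lemma limitin_htopology_iff:
  "limitin (htopology V) \<sigma> x sequentially \<longleftrightarrow>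
     x \<in> hcarrier V \<and> (\<forall>\<^sub>F n in sequentially. \<sigma> n \<in> hcarrier V) \<and>
     (\<lambda>n. hnorm V (\<sigma> n - x)) \<longlonglongrightarrow> 0"
proof -
  interpret Metric_space "hcarrier V" "hdist V" by (rule Metric_space_hdist)
  have nn: "\<bar>hnorm V (\<sigma> n - x)\<bar> = hdist V (\<sigma> n) x" if "\<sigma> n \<in> hcarrier V" "x \<in> hcarrier V" for n
    using that hnorm_nonneg[OF carrier_diff[of "\<sigma> n" x]] by (simp add: hdist_def)
  show ?thesis (is "?l \<longleftrightarrow> ?r")
  proof
    assume ?l
    then have x: "x \<in> hcarrier V"
      and ev: "\<And>e. e > 0 \<Longrightarrow> \<forall>\<^sub>F n in sequentially. \<sigma> n \<in> hcarrier V \<and> hdist V (\<sigma> n) x < e"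
      by (auto simp: htopology_def limitin_metric)
    have "(\<lambda>n. hnorm V (\<sigma> n - x)) \<longlonglongrightarrow> 0"
    proof (rule tendstoI)
      fix e :: real assume "e > 0"
      show "\<forall>\<^sub>F n in sequentially. dist (hnorm V (\<sigma> n - x)) 0 < e"
        using ev[OF \<open>e > 0\<close>] by eventually_elim (use nn x in auto)
    qed
    moreover have "\<forall>\<^sub>F n in sequentially. \<sigma> n \<in> hcarrier V"
      using ev[of 1] by (auto elim: eventually_mono)
    ultimately show ?r using x by blast
  next
    assume r: ?r
    have "\<forall>\<^sub>F n in sequentially. \<sigma> n \<in> hcarrier V \<and> hdist V (\<sigma> n) x < e" if "e > 0" for e
    proof -
      have "\<forall>\<^sub>F n in sequentially. dist (hnorm V (\<sigma> n - x)) 0 < e"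
        using r that by (auto dest: tendstoD)
      moreover have "\<forall>\<^sub>F n in sequentially. \<sigma> n \<in> hcarrier V" using r by blast
      ultimately show ?thesis by eventually_elim (use nn r in auto)
    qed
    then show ?l using r by (auto simp: htopology_def limitin_metric)
  qed
qed

lemma tendsto_hinner:
  assumes \<sigma>: "\<And>n. \<sigma> n \<in> hcarrier V" and x: "x \<in> hcarrier V"
    and \<sigma>x: "(\<lambda>n. hnorm V (\<sigma> n - x)) \<longlonglongrightarrow> 0"
    and \<tau>: "\<And>n. \<tau> n \<in> hcarrier V" and y: "y \<in> hcarrier V"
    and \<tau>y: "(\<lambda>n. hnorm V (\<tau> n - y)) \<longlonglongrightarrow> 0"
  shows "(\<lambda>n. hinner V (\<sigma> n) (\<tau> n)) \<longlonglongrightarrow> hinner V x y"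
proof (rule Lim_null[THEN iffD2], rule tendsto_0_le[where K=1])
  let ?b = "\<lambda>n. hnorm V (\<sigma> n - x) * (hnorm V (\<tau> n - y) + hnorm V y)
    + hnorm V x * hnorm V (\<tau> n - y)"
  have "?b \<longlonglongrightarrow> 0 * (0 + hnorm V y) + hnorm V x * 0"
    by (intro tendsto_intros \<sigma>x \<tau>y)
  then show "?b \<longlonglongrightarrow> 0" by simp
  have "norm (hinner V (\<sigma> n) (\<tau> n) - hinner V x y) \<le> ?b n" for n
  proof -
    have d: "\<sigma> n - x \<in> hcarrier V" "\<tau> n - y \<in> hcarrier V"
      using carrier_diff \<sigma> \<tau> x y by blast+
    have "hinner V (\<sigma> n) (\<tau> n) - hinner V x y
        = hinner V (\<sigma> n - x) (\<tau> n) + hinner V x (\<tau> n - y)"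
      using \<sigma> \<tau> x y by (simp add: hinner_diff_left hinner_diff_right)
    then have "norm (hinner V (\<sigma> n) (\<tau> n) - hinner V x y)
        \<le> hnorm V (\<sigma> n - x) * hnorm V (\<tau> n) + hnorm V x * hnorm V (\<tau> n - y)"
      using cmod_hinner_le[OF d(1) \<tau>[of n]] cmod_hinner_le[OF x d(2)]
        norm_triangle_ineq[of "hinner V (\<sigma> n - x) (\<tau> n)" "hinner V x (\<tau> n - y)"]
      by simp
    also have "\<dots> \<le> ?b n"
      using hnorm_triangle[OF d(2) y] hnorm_nonneg[OF d(1)] hnorm_nonneg[OF x]
      by (intro add_mono mult_left_mono) auto
    finally show ?thesis .
  qed
  then show "\<forall>\<^sub>F n in sequentially. norm (hinner V (\<sigma> n) (\<tau> n) - hinner V x y) \<le> norm (?b n) * 1"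
    by (intro always_eventually allI) (simp only: mult_1_right real_norm_def order_trans[OF _ abs_ge_self])
qed

lemma mcomplete_iff:
  "Metric_space.mcomplete (hcarrier V) (hdist V) \<longleftrightarrow>
    (\<forall>\<sigma>. (\<forall>n. \<sigma> n \<in> hcarrier V) \<longrightarrow>
      (\<forall>e>0. \<exists>N. \<forall>n\<ge>N. \<forall>m\<ge>N. hnorm V (\<sigma> n - \<sigma> m) < e) \<longrightarrow>
      (\<exists>x\<in>hcarrier V. (\<lambda>n. hnorm V (\<sigma> n - x)) \<longlonglongrightarrow> 0))"
proof -
  interpret Metric_space "hcarrier V" "hdist V" by (rule Metric_space_hdist)
  have C: "MCauchy \<sigma> \<longleftrightarrow> (\<forall>n. \<sigma> n \<in> hcarrier V) \<and>
      (\<forall>e>0. \<exists>N. \<forall>n\<ge>N. \<forall>m\<ge>N. hnorm V (\<sigma> n - \<sigma> m) < e)" for \<sigma>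
  proof (cases "\<forall>n. \<sigma> n \<in> hcarrier V")
    case True
    then have "hdist V (\<sigma> n) (\<sigma> m) = hnorm V (\<sigma> n - \<sigma> m)" for n m
      by (simp add: hdist_def)
    then show ?thesis using True by (simp add: MCauchy_def image_subset_iff)
  qed (auto simp: MCauchy_def)
  have L: "limitin mtopology \<sigma> x sequentially \<longleftrightarrow> x \<in> hcarrier V \<and>
      (\<lambda>n. hnorm V (\<sigma> n - x)) \<longlonglongrightarrow> 0" if "\<forall>n. \<sigma> n \<in> hcarrier V" for \<sigma> x
    using limitin_htopology_iff[of \<sigma> x] that by (simp add: htopology_def)
  show ?thesis
    unfolding mcomplete_def
  proof (intro all_cong1 iffI impI; (elim conjE)?)
    fix \<sigma>
    assume "MCauchy \<sigma> \<longrightarrow> (\<exists>x. limitin mtopology \<sigma> x sequentially)"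
      and "\<forall>n. \<sigma> n \<in> hcarrier V" "\<forall>e>0. \<exists>N. \<forall>n\<ge>N. \<forall>m\<ge>N. hnorm V (\<sigma> n - \<sigma> m) < e"
    then show "\<exists>x\<in>hcarrier V. (\<lambda>n. hnorm V (\<sigma> n - x)) \<longlonglongrightarrow> 0"
      using C[of \<sigma>] L[of \<sigma>] by blast
  next
    fix \<sigma>
    assume "(\<forall>n. \<sigma> n \<in> hcarrier V) \<longrightarrow>
        (\<forall>e>0. \<exists>N. \<forall>n\<ge>N. \<forall>m\<ge>N. hnorm V (\<sigma> n - \<sigma> m) < e) \<longrightarrow>
        (\<exists>x\<in>hcarrier V. (\<lambda>n. hnorm V (\<sigma> n - x)) \<longlonglongrightarrow> 0)"
      and "MCauchy \<sigma>"
    then show "\<exists>x. limitin mtopology \<sigma> x sequentially"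
      using C[of \<sigma>] L[of \<sigma>] by blast
  qed
qed

end

lemma (in complex_inner_product_space) hinner_sum_sum:
  assumes f: "\<And>i. i \<in> I \<Longrightarrow> f i \<in> hcarrier V" and g: "\<And>j. j \<in> J \<Longrightarrow> g j \<in> hcarrier V"
  shows "hinner V (\<Sum>i\<in>I. f i) (\<Sum>j\<in>J. g j) = (\<Sum>i\<in>I. \<Sum>j\<in>J. hinner V (f i) (g j))"
proof -
  have "hinner V (\<Sum>i\<in>I. f i) (\<Sum>j\<in>J. g j) = (\<Sum>i\<in>I. hinner V (f i) (\<Sum>j\<in>J. g j))"
    using f g by (intro hinner_sum_left carrier_sum)
  also have "\<dots> = (\<Sum>i\<in>I. \<Sum>j\<in>J. hinner V (f i) (g j))"
    using f g by (intro sum.cong refl hinner_sum_right)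
  finally show ?thesis .
qed

lemma (in complex_inner_product_space) cmod_hinner_le_sum_squares:
  assumes x: "x \<in> hcarrier V" and y: "y \<in> hcarrier V"
  shows "cmod (hinner V x y) \<le> (hnorm V x)\<^sup>2 + (hnorm V y)\<^sup>2"
proof -
  have "0 \<le> hnorm V x * hnorm V y" using x y hnorm_nonneg by (intro mult_nonneg_nonneg)
  then show ?thesis
    using cmod_hinner_le[OF x y] sum_squares_bound[of "hnorm V x" "hnorm V y"] by linarith
qed

lemma (in complex_inner_product_space) tendsto_hnorm:
  assumes \<sigma>: "\<And>n. \<sigma> n \<in> hcarrier V" and x: "x \<in> hcarrier V"
    and lim: "(\<lambda>n. hnorm V (\<sigma> n - x)) \<longlonglongrightarrow> 0"
  shows "(\<lambda>n. hnorm V (\<sigma> n)) \<longlonglongrightarrow> hnorm V x"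
  unfolding hnorm_def by (intro tendsto_real_sqrt tendsto_Re tendsto_hinner[OF \<sigma> x lim \<sigma> x lim])

lemma (in complex_inner_product_space) closure_of_sequence:
  assumes "y \<in> htopology V closure_of S" and S: "S \<subseteq> hcarrier V"
  shows "y \<in> hcarrier V" and "\<exists>\<sigma>. (\<forall>n. \<sigma> n \<in> S) \<and> (\<lambda>n. hnorm V (\<sigma> n - y)) \<longlonglongrightarrow> 0"
proof -
  interpret Metric_space "hcarrier V" "hdist V" by (rule Metric_space_hdist)
  have y: "y \<in> hcarrier V" and ex: "\<And>r. r > 0 \<Longrightarrow> \<exists>z\<in>S. hnorm V (z - y) < r"
    using assms hnorm_minus_commute[of y]
    by (auto simp: htopology_def metric_closure_of hdist_def subset_eq) metis
  then have "\<forall>n. \<exists>z\<in>S. hnorm V (z - y) < inverse (real (Suc n))"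
    by (meson inverse_positive_iff_positive of_nat_0_less_iff zero_less_Suc)
  then obtain \<sigma> where \<sigma>: "\<And>n. \<sigma> n \<in> S" "\<And>n. hnorm V (\<sigma> n - y) < inverse (real (Suc n))" by metis
  have nn: "0 \<le> hnorm V (\<sigma> n - y)" for n using \<sigma>(1) S y carrier_diff hnorm_nonneg by blast
  have "(\<lambda>n. hnorm V (\<sigma> n - y)) \<longlonglongrightarrow> 0"
    by (rule tendsto_sandwich[OF _ _ tendsto_const LIMSEQ_inverse_real_of_nat];
        intro always_eventually allI nn less_imp_le[OF \<sigma>(2)])
  with \<sigma>(1) y show "y \<in> hcarrier V" and "\<exists>\<sigma>. (\<forall>n. \<sigma> n \<in> S) \<and> (\<lambda>n. hnorm V (\<sigma> n - y)) \<longlonglongrightarrow> 0"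
    by blast+
qed

text \<open>By the Baire category theorem some sublevel set of \<open>q\<close> contains a ball, and homogeneity
  spreads the bound on this ball over the whole space.\<close>
lemma (in complex_hilbert_space) closed_sublevels_imp_bounded:
  fixes q :: "'a \<Rightarrow> real"
  assumes add: "\<And>x y. \<lbrakk>x \<in> hcarrier V; y \<in> hcarrier V\<rbrakk> \<Longrightarrow> q (x + y) \<le> 2 * q x + 2 * q y"
    and scale: "\<And>c x. x \<in> hcarrier V \<Longrightarrow> q (hscale V c x) = (cmod c)\<^sup>2 * q x"
    and closed: "\<And>\<sigma> x B. \<lbrakk>\<And>n. \<sigma> n \<in> hcarrier V; x \<in> hcarrier V;
      (\<lambda>n. hnorm V (\<sigma> n - x)) \<longlonglongrightarrow> 0; \<And>n. q (\<sigma> n) \<le> B\<rbrakk> \<Longrightarrow> q x \<le> B"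
  shows "\<exists>C. \<forall>x\<in>hcarrier V. q x \<le> C * (hnorm V x)\<^sup>2"
proof -
  interpret Metric_space "hcarrier V" "hdist V" by (rule Metric_space_hdist)
  define S where "S n = {x \<in> hcarrier V. q x \<le> real n}" for n
  have S_closed: "closedin mtopology (S n)" for n
    unfolding metric_closedin_iff_sequentially_closed
  proof (intro conjI allI impI)
    show "S n \<subseteq> hcarrier V" by (auto simp: S_def)
    fix \<sigma> x assume "range \<sigma> \<subseteq> S n \<and> limitin mtopology \<sigma> x sequentially"
    then have "\<And>i. \<sigma> i \<in> S n" "limitin (htopology V) \<sigma> x sequentially"
      by (auto simp: htopology_def)
    then show "x \<in> S n"
      using closed[of \<sigma> x "real n"] unfolding limitin_htopology_iff S_def by blast
  qed
  have "\<exists>n. mtopology interior_of S n \<noteq> {}"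
  proof (rule ccontr)
    assume "\<nexists>n. mtopology interior_of S n \<noteq> {}"
    then have "mtopology interior_of \<Union>(range S) = {}"
      using S_closed complete by (intro metric_Baire_category_alt) auto
    moreover have "\<Union>(range S) = hcarrier V"
      using real_arch_simple by (auto simp: S_def)
    ultimately show False
      using carrier_zero interior_of_topspace[of mtopology] by simp
  qed
  then obtain n x0 r where x0: "x0 \<in> hcarrier V" and r: "r > 0" and ball: "mball x0 r \<subseteq> S n"
    unfolding metric_interior_of by blast
  have small: "q y \<le> 4 * real n" if y: "y \<in> hcarrier V" "hnorm V y < r" for y
  proof -
    have "hdist V x0 (x0 + y) = hnorm V y"
      using x0 y carrier_add hnorm_scale[of y "-1"] by (simp add: hdist_def)
    then have "x0 + y \<in> S n" "x0 \<in> S n" using ball x0 y r carrier_add by auto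
    then have "q (x0 + y) \<le> n" "q (hscale V (-1) x0) \<le> n" using scale[OF x0, of "-1"] by (auto simp: S_def)
    then show ?thesis
      using add[OF carrier_add[OF x0 y(1)] carrier_scale[OF x0, of "-1"]] by simp
  qed
  have "q x \<le> (16 * real n / r\<^sup>2) * (hnorm V x)\<^sup>2" if x: "x \<in> hcarrier V" for x
  proof (cases "hnorm V x = 0")
    case True
    then have "x = hscale V 0 x" using hnorm_eq_zero x by simp
    then have "q x = 0" using scale[OF x, of 0] by simp
    then show ?thesis by simp
  next
    case False
    then have pos: "hnorm V x > 0" using hnorm_nonneg[OF x] by simp
    let ?t = "r / (2 * hnorm V x)"
    have t: "?t > 0" using r pos by simp
    have "hnorm V (hscale V (of_real ?t) x) = ?t * hnorm V x"
      by (simp only: hnorm_scale[OF x] norm_of_real abs_of_pos[OF t])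
    then have "hnorm V (hscale V (of_real ?t) x) < r" using r pos by simp
    then have "q (hscale V (of_real ?t) x) \<le> 4 * real n" using small[OF carrier_scale[OF x]] by blast
    then have "?t\<^sup>2 * q x \<le> 4 * real n"
      by (simp only: scale[OF x] norm_of_real abs_of_pos[OF t])
    then show ?thesis using r pos by (simp add: field_simps power2_eq_square)
  qed
  then show ?thesis by blast
qed

section \<open>Bounded operators and their adjoints\<close>

lemma bounded_operatorD:
  assumes "bounded_operator V W T"
  shows "x \<in> hcarrier V \<Longrightarrow> T x \<in> hcarrier W"
    and "\<lbrakk>x \<in> hcarrier V; y \<in> hcarrier V\<rbrakk> \<Longrightarrow> T (x + y) = T x + T y"
    and "x \<in> hcarrier V \<Longrightarrow> T (hscale V c x) = hscale W c (T x)"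
    and "\<exists>B. \<forall>x\<in>hcarrier V. hnorm W (T x) \<le> B * hnorm V x"
  using assms by (auto simp: bounded_operator_def)

lemma (in complex_inner_product_space) bounded_operator_diff:
  assumes "bounded_operator V W T" "x \<in> hcarrier V" "y \<in> hcarrier V"
  shows "T (x - y) = T x - T y"
proof -
  have "T (x - y) + T y = T x"
    using bounded_operatorD(2)[OF assms(1) carrier_diff[OF assms(2,3)] assms(3)] by simp
  then show ?thesis by (simp add: algebra_simps)
qed

lemma (in complex_inner_product_space) bounded_operator_tendsto:
  assumes W: "complex_inner_product_space W" and T: "bounded_operator V W T"
    and \<sigma>: "\<And>n. \<sigma> n \<in> hcarrier V" and x: "x \<in> hcarrier V"
    and lim: "(\<lambda>n. hnorm V (\<sigma> n - x)) \<longlonglongrightarrow> 0"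
  shows "(\<lambda>n. hnorm W (T (\<sigma> n) - T x)) \<longlonglongrightarrow> 0"
proof -
  interpret W: complex_inner_product_space W by fact
  obtain B where B: "\<And>x. x \<in> hcarrier V \<Longrightarrow> hnorm W (T x) \<le> B * hnorm V x"
    using bounded_operatorD(4)[OF T] by blast
  have "(\<lambda>n. B * hnorm V (\<sigma> n - x)) \<longlonglongrightarrow> B * 0" by (intro tendsto_intros lim)
  then have lim0: "(\<lambda>n. B * hnorm V (\<sigma> n - x)) \<longlonglongrightarrow> 0" by simp
  have le: "0 \<le> hnorm W (T (\<sigma> n) - T x) \<and> hnorm W (T (\<sigma> n) - T x) \<le> B * hnorm V (\<sigma> n - x)" for n
  proof -
    have d: "\<sigma> n - x \<in> hcarrier V" using carrier_diff \<sigma> x by blast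
    show ?thesis
      using B[OF d] W.hnorm_nonneg[OF bounded_operatorD(1)[OF T d]]
      by (simp add: bounded_operator_diff[OF T \<sigma> x])
  qed
  show ?thesis
  proof (rule tendsto_sandwich[OF _ _ tendsto_const lim0])
    show "\<forall>\<^sub>F n in sequentially. 0 \<le> hnorm W (T (\<sigma> n) - T x)" using le by simp
    show "\<forall>\<^sub>F n in sequentially. hnorm W (T (\<sigma> n) - T x) \<le> B * hnorm V (\<sigma> n - x)" using le by simp
  qed
qed

lemma bounded_operator_id: "bounded_operator V V (\<lambda>x. x)"
  by (auto simp: bounded_operator_def intro: exI[of _ 1])

lemma bounded_operator_funpow:
  assumes V: "complex_inner_product_space V" and T: "bounded_operator V V T"
  shows "bounded_operator V V (T ^^ n)"
proof (induction n)
  case 0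
  then show ?case using bounded_operator_id by (simp add: id_def)
next
  case (Suc n)
  interpret complex_inner_product_space V by fact
  obtain B where B: "\<And>x. x \<in> hcarrier V \<Longrightarrow> hnorm V (T x) \<le> B * hnorm V x"
    using bounded_operatorD(4)[OF T] by blast
  obtain C where C: "\<And>x. x \<in> hcarrier V \<Longrightarrow> hnorm V ((T ^^ n) x) \<le> C * hnorm V x"
    using bounded_operatorD(4)[OF Suc] by blast
  note S = bounded_operatorD[OF Suc] and T' = bounded_operatorD[OF T]
  have "hnorm V (T ((T ^^ n) x)) \<le> (\<bar>B\<bar> * C) * hnorm V x" if x: "x \<in> hcarrier V" for x
  proof -
    have "hnorm V (T ((T ^^ n) x)) \<le> B * hnorm V ((T ^^ n) x)" using B S(1)[OF x] by blast
    also have "\<dots> \<le> \<bar>B\<bar> * hnorm V ((T ^^ n) x)"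
      using hnorm_nonneg[OF S(1)[OF x]] by (intro mult_right_mono) auto
    also have "\<dots> \<le> \<bar>B\<bar> * (C * hnorm V x)" using C[OF x] by (intro mult_left_mono) auto
    finally show ?thesis by (simp add: mult.assoc)
  qed
  then show ?case
    using S(1-3) T'(1-3) unfolding bounded_operator_def
    by (auto intro!: exI[of _ "\<bar>B\<bar> * C"])
qed

lemma bounded_operator_sum:
  assumes V: "complex_inner_product_space V" and W: "complex_inner_product_space W"
    and T: "bounded_operator V W T" and f: "\<And>i. i \<in> I \<Longrightarrow> f i \<in> hcarrier V"
  shows "T (\<Sum>i\<in>I. f i) = (\<Sum>i\<in>I. T (f i))"
proof -
  interpret V: complex_inner_product_space V by fact
  interpret W: complex_inner_product_space W by fact
  have "T 0 = 0" using bounded_operatorD(2)[OF T V.carrier_zero V.carrier_zero] by simp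
  then show ?thesis
    using f
  proof (induction I rule: infinite_finite_induct)
    case (insert i I)
    then show ?case
      using bounded_operatorD(2)[OF T, of "f i" "sum f I"] V.carrier_sum[of I f] by simp
  qed simp_all
qed

text \<open>The function \<open>x \<mapsto> \<parallel>x\<parallel>\<^sup>2 - 2 Re (\<phi> x)\<close> is bounded below, and the parallelogram law turns every
  minimising sequence into a Cauchy sequence; the first-order condition at its limit says that
  the limit represents \<open>\<phi>\<close>.\<close>
lemma (in complex_hilbert_space) riesz_representation:
  assumes add: "\<And>x y. \<lbrakk>x \<in> hcarrier V; y \<in> hcarrier V\<rbrakk> \<Longrightarrow> \<phi> (x + y) = \<phi> x + \<phi> y"
    and scale: "\<And>c x. x \<in> hcarrier V \<Longrightarrow> \<phi> (hscale V c x) = c * \<phi> x"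
    and bound: "\<And>x. x \<in> hcarrier V \<Longrightarrow> cmod (\<phi> x) \<le> B * hnorm V x"
  shows "\<exists>v\<in>hcarrier V. \<forall>x\<in>hcarrier V. hinner V v x = \<phi> x"
proof -
  define F where "F x = (hnorm V x)\<^sup>2 - 2 * Re (\<phi> x)" for x
  have F_add: "F (x + hscale V (of_real t) z) =
      F x + t\<^sup>2 * (hnorm V z)\<^sup>2 + 2 * t * Re (hinner V x z - \<phi> z)"
    if x: "x \<in> hcarrier V" and z: "z \<in> hcarrier V" for x z t
  proof -
    let ?w = "hscale V (of_real t) z"
    have w: "?w \<in> hcarrier V" using carrier_scale z by blast
    have "hinner V z x = cnj (hinner V x z)" by (rule hinner_commute[OF z x])
    then show ?thesis
      unfolding F_def hnorm_power2[OF carrier_add[OF x w]] hnorm_power2[OF x] hnorm_power2[OF z]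
      using x z w by (simp add: hinner_add_left hinner_add_right carrier_add hinner_scale_left
          hinner_scale_right add scale power2_eq_square algebra_simps)
  qed
  have F_ge: "- B\<^sup>2 \<le> F x" if "x \<in> hcarrier V" for x
  proof -
    have "Re (\<phi> x) \<le> B * hnorm V x" using bound[OF that] complex_Re_le_cmod order_trans by blast
    moreover have "0 \<le> (hnorm V x - B)\<^sup>2" by simp
    ultimately show ?thesis by (simp add: F_def power2_diff algebra_simps)
  qed
  define m where "m = (INF x\<in>hcarrier V. F x)"
  have m_le: "m \<le> F x" if "x \<in> hcarrier V" for x
    unfolding m_def using F_ge that by (intro cINF_lower bdd_belowI2[of _ "- B\<^sup>2"]) auto
  have "\<exists>x\<in>hcarrier V. F x < m + 1 / Suc n" for n
  proof -
    have "\<exists>y\<in>F ` hcarrier V. y < m + 1 / Suc n"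
      using carrier_zero unfolding m_def by (intro cInf_lessD) auto
    then show ?thesis by blast
  qed
  then obtain \<sigma> where \<sigma>: "\<And>n. \<sigma> n \<in> hcarrier V" and F\<sigma>: "\<And>n. F (\<sigma> n) < m + 1 / Suc n"
    by metis
  have close: "(hnorm V (\<sigma> n - \<sigma> k))\<^sup>2 \<le> 2 / Suc n + 2 / Suc k" for n k
  proof -
    define d where "d = \<sigma> k - \<sigma> n"
    have d: "d \<in> hcarrier V" using \<sigma> carrier_diff by (simp add: d_def)
    have mid: "\<sigma> n + hscale V (of_real (1/2)) d \<in> hcarrier V"
      using carrier_add[OF \<sigma> carrier_scale[OF d]] .
    have "F (\<sigma> k) = F (\<sigma> n + hscale V (of_real 1) d)" by (simp add: d_def)
    then have "F (\<sigma> k) = F (\<sigma> n) + (hnorm V d)\<^sup>2 + 2 * Re (hinner V (\<sigma> n) d - \<phi> d)"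
      using F_add[OF \<sigma>[of n] d, of 1] by simp
    moreover have "m \<le> F (\<sigma> n) + (hnorm V d)\<^sup>2 / 4 + Re (hinner V (\<sigma> n) d - \<phi> d)"
      using m_le[OF mid] F_add[OF \<sigma>[of n] d, of "1/2"] by (simp add: power2_eq_square)
    ultimately have "(hnorm V d)\<^sup>2 \<le> 2 / Suc n + 2 / Suc k"
      using F\<sigma>[of n] F\<sigma>[of k] add_divide_distrib[of 1 1 "real (Suc n)"]
        add_divide_distrib[of 1 1 "real (Suc k)"] by simp
    then show ?thesis using hnorm_minus_commute[OF \<sigma>[of n] \<sigma>[of k]] by (simp add: d_def)
  qed
  have "\<exists>N. \<forall>n\<ge>N. \<forall>k\<ge>N. hnorm V (\<sigma> n - \<sigma> k) < e" if "e > 0" for e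
  proof -
    obtain N where N: "inverse (real (Suc N)) < e\<^sup>2 / 4"       using reals_Archimedean[of "e\<^sup>2/4"] \<open>e > 0\<close> by (metis divide_pos_pos zero_less_numeral
          zero_less_power)
    have "hnorm V (\<sigma> n - \<sigma> k) < e" if "n \<ge> N" "k \<ge> N" for n k
    proof -
      have "1 / real (Suc n) \<le> inverse (real (Suc N))" "1 / real (Suc k) \<le> inverse (real (Suc N))"
        using that by (auto simp: field_simps)
      then have "(hnorm V (\<sigma> n - \<sigma> k))\<^sup>2 < e\<^sup>2" using close[of n k] N by simp
      then show ?thesis using \<open>e > 0\<close> by (simp add: power2_less_imp_less)
    qed
    then show ?thesis by blast
  qed
  then obtain v where v: "v \<in> hcarrier V" and lim: "(\<lambda>n. hnorm V (\<sigma> n - v)) \<longlonglongrightarrow> 0"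
    using complete \<sigma> unfolding mcomplete_iff by blast
  \<comment> \<open>perturbing the minimising sequence instead of v avoids an argument for the continuity of F\<close>
  have Re_eq: "Re (hinner V v z) = Re (\<phi> z)" if z: "z \<in> hcarrier V" for z
  proof -
    define r where "r = Re (hinner V v z - \<phi> z)"
    define a where "a = (hnorm V z)\<^sup>2"
    have a: "a \<ge> 0" by (simp add: a_def)
    have conv: "(\<lambda>n. hinner V (\<sigma> n) z) \<longlonglongrightarrow> hinner V v z"
      using tendsto_hinner[OF \<sigma> v lim, of "\<lambda>_. z" z] z hinner_zero_right[OF carrier_zero]
      by (simp add: hnorm_def)
    have nn: "0 \<le> t\<^sup>2 * a + 2 * t * r" for t
    proof (rule LIMSEQ_le)
      show "(\<lambda>n. - inverse (real (Suc n))) \<longlonglongrightarrow> 0"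
        using tendsto_minus[OF LIMSEQ_inverse_real_of_nat] by simp
      show "(\<lambda>n. t\<^sup>2 * a + 2 * t * Re (hinner V (\<sigma> n) z - \<phi> z)) \<longlonglongrightarrow> t\<^sup>2 * a + 2 * t * r"
        unfolding r_def by (intro tendsto_intros conv)
      have "- inverse (real (Suc n)) \<le> t\<^sup>2 * a + 2 * t * Re (hinner V (\<sigma> n) z - \<phi> z)" for n
        using m_le[OF carrier_add[OF \<sigma>[of n] carrier_scale[OF z, of "of_real t"]]]
          F_add[OF \<sigma>[of n] z, of t] F\<sigma>[of n]
        by (simp add: a_def inverse_eq_divide)
      then show "\<exists>N. \<forall>n\<ge>N. - inverse (real (Suc n)) \<le>
          t\<^sup>2 * a + 2 * t * Re (hinner V (\<sigma> n) z - \<phi> z)" by blast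
    qed
    define t where "t = r / (a + 1)"
    have r: "r = t * (a + 1)" using a by (simp add: t_def)
    have "t\<^sup>2 * (a + 2) \<le> 0"
      using nn[of "- t"] unfolding r by (simp add: power2_eq_square algebra_simps)
    then have "r = 0" using a by (simp add: mult_le_0_iff r)
    then show ?thesis by (simp add: r_def)
  qed
  have "hinner V v z = \<phi> z" if z: "z \<in> hcarrier V" for z
  proof (rule complex_eqI)
    show "Re (hinner V v z) = Re (\<phi> z)" by (rule Re_eq[OF z])
    show "Im (hinner V v z) = Im (\<phi> z)"
      using Re_eq[OF carrier_scale[OF z, of \<i>]] z v by (simp add: hinner_scale_right scale)
  qed
  then show ?thesis using v by blast
qed

text \<open>The functional \<open>z \<mapsto> \<langle>y, T z\<rangle>\<close> is bounded, so by the Riesz theorem the vector that the definition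
  of the adjoint describes does exist.\<close>
lemma hadjoint_exists:
  assumes V: "complex_hilbert_space V" and W: "complex_inner_product_space W"
    and T: "bounded_operator V W T" and y: "y \<in> hcarrier W"
  shows "hadjoint V W T y \<in> hcarrier V"
    and "z \<in> hcarrier V \<Longrightarrow> hinner V z (hadjoint V W T y) = hinner W (T z) y"
proof -
  interpret V: complex_hilbert_space V by fact
  interpret W: complex_inner_product_space W by fact
  note T' = bounded_operatorD[OF T]
  obtain B where B: "\<And>x. x \<in> hcarrier V \<Longrightarrow> hnorm W (T x) \<le> B * hnorm V x"
    using T'(4) by blast
  have "\<exists>v\<in>hcarrier V. \<forall>x\<in>hcarrier V. hinner V v x = hinner W y (T x)"
  proof (rule V.riesz_representation[where B="hnorm W y * B"])
    fix x assume x: "x \<in> hcarrier V"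
    have "cmod (hinner W y (T x)) \<le> hnorm W y * hnorm W (T x)"
      using W.cmod_hinner_le[OF y T'(1)[OF x]] .
    also have "\<dots> \<le> hnorm W y * (B * hnorm V x)"
      by (intro mult_left_mono B x W.hnorm_nonneg y)
    finally show "cmod (hinner W y (T x)) \<le> hnorm W y * B * hnorm V x" by (simp add: mult.assoc)
  qed (use T' y in \<open>auto simp: W.hinner_add_right W.hinner_scale_right\<close>)
  then obtain v where v: "v \<in> hcarrier V" "\<And>x. x \<in> hcarrier V \<Longrightarrow> hinner V v x = hinner W y (T x)"
    by blast
  have eq: "hinner V x v = hinner W (T x) y" if "x \<in> hcarrier V" for x
    using v V.hinner_commute[OF that v(1)] W.hinner_commute[OF T'(1)[OF that] y] that by simp
  have "hadjoint V W T y = v"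
    unfolding hadjoint_def by (rule V.the_representative[OF v(1) eq])
  then show "hadjoint V W T y \<in> hcarrier V"
    and "z \<in> hcarrier V \<Longrightarrow> hinner V z (hadjoint V W T y) = hinner W (T z) y"
    using v eq by auto
qed

lemma hadjoint_power_inner:
  assumes V: "complex_hilbert_space V" and T: "bounded_operator V V T" and y: "y \<in> hcarrier V"
  shows "(hadjoint V V T ^^ m) y \<in> hcarrier V"
    and "z \<in> hcarrier V \<Longrightarrow> hinner V z ((hadjoint V V T ^^ m) y) = hinner V ((T ^^ m) z) y"
proof -
  interpret complex_hilbert_space V by fact
  note adj = hadjoint_exists[OF V complex_inner_product_space_axioms T]
  have "(hadjoint V V T ^^ m) y \<in> hcarrier V \<and>
      (\<forall>z\<in>hcarrier V. hinner V z ((hadjoint V V T ^^ m) y) = hinner V ((T ^^ m) z) y)"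
  proof (induction m)
    case (Suc m)
    have "hinner V z (hadjoint V V T ((hadjoint V V T ^^ m) y)) = hinner V ((T ^^ Suc m) z) y"
      if z: "z \<in> hcarrier V" for z
    proof -
      have "(T ^^ Suc m) z = (T ^^ m) (T z)" by (simp only: funpow_Suc_right o_apply)
      then show ?thesis using adj(2)[of _ z] Suc z bounded_operatorD(1)[OF T z] by simp
    qed
    then show ?case using Suc adj(1) by simp
  qed (use y in simp)
  then show "(hadjoint V V T ^^ m) y \<in> hcarrier V"
    and "z \<in> hcarrier V \<Longrightarrow> hinner V z ((hadjoint V V T ^^ m) y) = hinner V ((T ^^ m) z) y"
    by blast+
qed

section \<open>Projections onto closed subspaces\<close>

lemma hnorm_restrict: "hnorm (V\<lparr>hcarrier := Z\<rparr>) = hnorm V"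
  by (simp add: fun_eq_iff hnorm_def)

context complex_hilbert_space
begin

lemma closed_subspace_hilbert:
  assumes Z: "subspace Z" "Z \<subseteq> hcarrier V"
    and closed: "\<And>\<sigma> x. \<lbrakk>\<And>n. \<sigma> n \<in> Z; x \<in> hcarrier V; (\<lambda>n. hnorm V (\<sigma> n - x)) \<longlonglongrightarrow> 0\<rbrakk>
      \<Longrightarrow> x \<in> Z"
  shows "complex_hilbert_space (V\<lparr>hcarrier := Z\<rparr>)"
proof -
  have sub: "x \<in> Z \<Longrightarrow> x \<in> hcarrier V" for x using Z by blast
  have ips: "complex_inner_product_space (V\<lparr>hcarrier := Z\<rparr>)"
  proof (intro complex_inner_product_space.intro complex_inner_product_space_axioms.intro)
    show "vector_space (hscale (V\<lparr>hcarrier := Z\<rparr>))" using vector_space_axioms by simp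
    show "module.subspace (hscale (V\<lparr>hcarrier := Z\<rparr>)) (hcarrier (V\<lparr>hcarrier := Z\<rparr>))"
      using Z(1) by simp
    show "hinner (V\<lparr>hcarrier := Z\<rparr>) x y = cnj (hinner (V\<lparr>hcarrier := Z\<rparr>) y x)"
      if "x \<in> hcarrier (V\<lparr>hcarrier := Z\<rparr>)" "y \<in> hcarrier (V\<lparr>hcarrier := Z\<rparr>)" for x y
      using that hinner_commute[of x y] sub by simp
  qed (use sub in \<open>auto simp: hinner_add_right hinner_scale_right hinner_nonneg hinner_eq_zero\<close>)
  interpret S: complex_inner_product_space "V\<lparr>hcarrier := Z\<rparr>" by (rule ips)
  show ?thesis
  proof (intro complex_hilbert_space.intro complex_hilbert_space_axioms.intro ips)
    show "Metric_space.mcomplete (hcarrier (V\<lparr>hcarrier := Z\<rparr>)) (hdist (V\<lparr>hcarrier := Z\<rparr>))"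
      unfolding S.mcomplete_iff hnorm_restrict
    proof (intro allI impI)
      fix \<sigma> :: "nat \<Rightarrow> 'a"
      assume \<sigma>: "\<forall>n. \<sigma> n \<in> hcarrier (V\<lparr>hcarrier := Z\<rparr>)"
        and cauchy: "\<forall>e>0. \<exists>N. \<forall>n\<ge>N. \<forall>m\<ge>N. hnorm V (\<sigma> n - \<sigma> m) < e"
      have "\<forall>n. \<sigma> n \<in> hcarrier V" using \<sigma> sub by simp
      then obtain x where "x \<in> hcarrier V" "(\<lambda>n. hnorm V (\<sigma> n - x)) \<longlonglongrightarrow> 0"
        using complete cauchy unfolding mcomplete_iff by blast
      then show "\<exists>x\<in>hcarrier (V\<lparr>hcarrier := Z\<rparr>). (\<lambda>n. hnorm V (\<sigma> n - x)) \<longlonglongrightarrow> 0"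
        using closed[of \<sigma> x] \<sigma> by auto
    qed
  qed
qed

text \<open>The projection onto a closed subspace \<open>Z\<close> is the adjoint of the inclusion of \<open>Z\<close>; the
  operator obtained here is its complement, the projection onto the vectors orthogonal to \<open>Z\<close>.\<close>
lemma orthogonal_projection_exists:
  assumes Z: "subspace Z" "Z \<subseteq> hcarrier V"
    and closed: "\<And>\<sigma> x. \<lbrakk>\<And>n. \<sigma> n \<in> Z; x \<in> hcarrier V; (\<lambda>n. hnorm V (\<sigma> n - x)) \<longlonglongrightarrow> 0\<rbrakk>
      \<Longrightarrow> x \<in> Z"
  shows "\<exists>P. selfadjoint_projection V P \<and>
    (\<forall>u\<in>hcarrier V. \<forall>v\<in>hcarrier V.
      u - v \<in> Z \<longrightarrow> (\<forall>z\<in>Z. hinner V z v = 0) \<longrightarrow> P u = v)"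
proof -
  define S where "S = V\<lparr>hcarrier := Z\<rparr>"
  have S: "complex_hilbert_space S"
    unfolding S_def by (rule closed_subspace_hilbert[OF Z closed])
  have [simp]: "hcarrier S = Z" "hinner S = hinner V" "hscale S = hscale V" "hnorm S = hnorm V"
    by (auto simp: S_def hnorm_restrict)
  have sub: "x \<in> Z \<Longrightarrow> x \<in> hcarrier V" for x using Z by blast
  have incl: "bounded_operator S V (\<lambda>x. x)"
    using sub by (auto simp: bounded_operator_def intro: exI[of _ 1])
  define E where "E = hadjoint S V (\<lambda>x. x)"
  have E: "E y \<in> Z" "z \<in> Z \<Longrightarrow> hinner V z (E y) = hinner V z y" if "y \<in> hcarrier V" for y z
    using hadjoint_exists[OF S complex_inner_product_space_axioms incl that] by (auto simp: E_def)
  define P where "P y = y - E y" for y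
  have PV: "P y \<in> hcarrier V" if "y \<in> hcarrier V" for y
    using that E(1) sub carrier_diff by (simp add: P_def)
  have orth: "hinner V z (P y) = 0" if "y \<in> hcarrier V" "z \<in> Z" for y z
    using E[OF that(1)] that sub by (simp add: P_def hinner_diff_right)
  have char: "P u = v" if u: "u \<in> hcarrier V" and v: "v \<in> hcarrier V" and uv: "u - v \<in> Z"
    and ov: "\<And>z. z \<in> Z \<Longrightarrow> hinner V z v = 0" for u v
  proof -
    have w: "P u - v \<in> Z"
      using subspace_diff[OF Z(1) uv E(1)[OF u]] by (simp add: P_def algebra_simps)
    then have "hinner V (P u - v) (P u - v) = 0"
      using orth[OF u w] ov[OF w] PV[OF u] v sub[OF w] by (simp add: hinner_diff_right)
    then show ?thesis using hinner_eq_zero[OF sub[OF w]] by simp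
  qed
  have orth': "hinner V (P x) z = 0" if "x \<in> hcarrier V" "z \<in> Z" for x z
    using orth[OF that] hinner_commute[OF PV[OF that(1)] sub[OF that(2)]] by simp
  have split: "hinner V x (P y) = hinner V (P x) (P y)" "hinner V (P x) y = hinner V (P x) (P y)"
    if x: "x \<in> hcarrier V" and y: "y \<in> hcarrier V" for x y
  proof -
    have "x = P x + E x" "y = P y + E y" by (auto simp: P_def)
    then show "hinner V x (P y) = hinner V (P x) (P y)" "hinner V (P x) y = hinner V (P x) (P y)"
      using hinner_add_left[OF PV[OF x] sub[OF E(1)[OF x]] PV[OF y]]
        hinner_add_right[OF PV[OF x] PV[OF y] sub[OF E(1)[OF y]]]
        orth[OF y E(1)[OF x]] orth'[OF x E(1)[OF y]] by auto
  qed
  have diffE: "x - P x = E x" for x by (simp add: P_def)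
  have "selfadjoint_projection V P"
    unfolding selfadjoint_projection_def bounded_operator_def
  proof (intro conjI ballI allI)
    show "P \<in> hcarrier V \<rightarrow> hcarrier V" using PV by blast
    show "P (x + y) = P x + P y" if xy: "x \<in> hcarrier V" "y \<in> hcarrier V" for x y
    proof (rule char)
      have "x + y - (P x + P y) = E x + E y" by (simp add: P_def)
      then show "x + y - (P x + P y) \<in> Z" using E(1) xy subspace_add[OF Z(1)] by simp
    qed (use xy PV orth sub carrier_add hinner_add_right in auto)
    show "P (hscale V c x) = hscale V c (P x)" if x: "x \<in> hcarrier V" for c x
    proof (rule char)
      have "hscale V c x - hscale V c (P x) = hscale V c (E x)"
        by (simp add: scale_right_diff_distrib[symmetric] diffE)
      then show "hscale V c x - hscale V c (P x) \<in> Z"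
        using E(1)[OF x] subspace_scale[OF Z(1)] by simp
    qed (use x PV orth sub carrier_scale hinner_scale_right in auto)
    show "\<exists>B. \<forall>x\<in>hcarrier V. hnorm V (P x) \<le> B * hnorm V x"
    proof (intro exI ballI)
      fix x assume x: "x \<in> hcarrier V"
      have "(hnorm V (P x))\<^sup>2 = Re (hinner V (P x) x)"
        using hnorm_power2[OF PV[OF x]] split[OF x x] by simp
      also have "\<dots> \<le> hnorm V (P x) * hnorm V x" using Re_hinner_le[OF PV[OF x] x] .
      finally show "hnorm V (P x) \<le> 1 * hnorm V x"
        using hnorm_nonneg[OF PV[OF x]] hnorm_nonneg[OF x]
        by (cases "hnorm V (P x) = 0") (auto simp: power2_eq_square)
    qed
    show "P (P x) = P x" if x: "x \<in> hcarrier V" for x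
      using subspace_0[OF Z(1)] x PV orth by (intro char) auto
    show "hadjoint V V P x = P x" if x: "x \<in> hcarrier V" for x
      unfolding hadjoint_def using PV[OF x] split x by (intro the_representative) auto
  qed
  then show ?thesis using char by blast
qed

end

lemma selfadjoint_projection_inner:
  assumes V: "complex_hilbert_space V" and P: "selfadjoint_projection V P" and x: "x \<in> hcarrier V"
  shows "hinner V x (P x) = of_real ((hnorm V (P x))\<^sup>2)"
proof -
  interpret complex_hilbert_space V by fact
  have b: "bounded_operator V V P" and PP: "P (P x) = P x" and adj: "\<And>x. x \<in> hcarrier V \<Longrightarrow> hadjoint V V P x = P x"
    using P x by (auto simp: selfadjoint_projection_def)
  have Px: "P x \<in> hcarrier V" using bounded_operatorD(1)[OF b x] .
  have "hinner V x (P (P x)) = hinner V (P x) (P x)"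
    using hadjoint_exists(2)[OF V complex_inner_product_space_axioms b Px x] adj[OF Px] by simp
  then show ?thesis using hinner_self[OF Px] PP by simp
qed

section \<open>The Hilbert space of a positive semidefinite kernel\<close>

definition scale_fun :: "complex \<Rightarrow> ('x \<Rightarrow> complex) \<Rightarrow> 'x \<Rightarrow> complex" where
  "scale_fun a f = (\<lambda>x. a * f x)"

lemma vector_space_scale_fun: "vector_space scale_fun"
  by unfold_locales (auto simp: scale_fun_def fun_eq_iff algebra_simps)

abbreviation finsupp :: "('x \<Rightarrow> complex) \<Rightarrow> bool" where
  "finsupp c \<equiv> finite {x. c x \<noteq> 0}"

lemma finsupp_add: "finsupp c \<Longrightarrow> finsupp d \<Longrightarrow> finsupp (c + d)"
  by (rule finite_subset[of _ "{x. c x \<noteq> 0} \<union> {x. d x \<noteq> 0}"]) auto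

lemma finsupp_scale: "finsupp c \<Longrightarrow> finsupp (scale_fun a c)"
  by (rule finite_subset[of _ "{x. c x \<noteq> 0}"]) (auto simp: scale_fun_def)

lemma finsupp_diff: "finsupp c \<Longrightarrow> finsupp d \<Longrightarrow> finsupp (c - d)"
  by (rule finite_subset[of _ "{x. c x \<noteq> 0} \<union> {x. d x \<noteq> 0}"]) auto

lemma finsupp_zero: "finsupp 0" by simp

lemmas finsupps = finsupp_add finsupp_scale finsupp_diff finsupp_zero

definition pairing :: "('x \<Rightarrow> complex) \<Rightarrow> ('x \<Rightarrow> complex) \<Rightarrow> complex" where
  "pairing c f = (\<Sum>x | c x \<noteq> 0. cnj (c x) * f x)"

lemma pairing_superset:
  "finite F \<Longrightarrow> {x. c x \<noteq> 0} \<subseteq> F \<Longrightarrow> pairing c f = (\<Sum>x\<in>F. cnj (c x) * f x)"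
  unfolding pairing_def by (intro sum.mono_neutral_left) auto

lemma pairing_add_left:
  assumes "finsupp c" "finsupp d"
  shows "pairing (c + d) f = pairing c f + pairing d f"
proof -
  have "finite ({x. c x \<noteq> 0} \<union> {x. d x \<noteq> 0})" (is "finite ?F") using assms by simp
  then have F: "pairing c f = (\<Sum>x\<in>?F. cnj (c x) * f x)" "pairing d f = (\<Sum>x\<in>?F. cnj (d x) * f x)"
    "pairing (c + d) f = (\<Sum>x\<in>?F. cnj ((c + d) x) * f x)"
    by (rule pairing_superset; force)+
  show ?thesis unfolding F by (simp add: distrib_right sum.distrib)
qed

lemma pairing_scale_left: "pairing (scale_fun a c) f = cnj a * pairing c f"
proof (cases "a = 0")
  case False
  then show ?thesis by (simp add: pairing_def scale_fun_def sum_distrib_left mult.assoc)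
qed (simp add: pairing_def scale_fun_def)

lemma pairing_add_right: "pairing c (f + g) = pairing c f + pairing c g"
  by (simp add: pairing_def sum.distrib algebra_simps)

lemma pairing_scale_right: "pairing c (scale_fun a f) = a * pairing c f"
  by (simp add: pairing_def scale_fun_def sum_distrib_left mult_ac)

lemma diff_scale_fun: "f - g = f + scale_fun (-1) g"
  by (simp add: scale_fun_def fun_eq_iff)

lemma pairing_diff_left:
  assumes "finsupp c" "finsupp d"
  shows "pairing (c - d) f = pairing c f - pairing d f"
  using assms by (simp add: diff_scale_fun pairing_add_left finsupp_scale pairing_scale_left)

lemma pairing_diff_right: "pairing c (f - g) = pairing c f - pairing c g"
  by (simp add: diff_scale_fun pairing_add_right pairing_scale_right)

lemma pairing_zero_left: "pairing 0 f = 0"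
  by (simp add: pairing_def)

lemma pairing_zero_right: "pairing c 0 = 0"
  by (simp add: pairing_def)

lemma pairing_delta: "pairing (\<lambda>y. if y = x then 1 else 0) f = f x"
  by (simp add: pairing_def)

lemma finsupp_delta: "finsupp (\<lambda>y. if y = x then 1 else 0)"
  by (simp add: if_distrib)

lemmas pairing_simps = pairing_add_left pairing_scale_left pairing_add_right pairing_scale_right
  pairing_diff_left pairing_diff_right pairing_zero_left pairing_zero_right

locale psd_kernel =
  fixes k :: "'x \<Rightarrow> 'x \<Rightarrow> complex"
  assumes hermitian: "k x y = cnj (k y x)"
    and psd: "finite F \<Longrightarrow> 0 \<le> Re (\<Sum>x\<in>F. \<Sum>y\<in>F. cnj (c x) * c y * k x y)"
begin

definition kvec :: "('x \<Rightarrow> complex) \<Rightarrow> 'x \<Rightarrow> complex" where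
  "kvec c = (\<lambda>x. \<Sum>y | c y \<noteq> 0. c y * k x y)"

lemma kvec_superset:
  "finite F \<Longrightarrow> {x. c x \<noteq> 0} \<subseteq> F \<Longrightarrow> kvec c x = (\<Sum>y\<in>F. c y * k x y)"
  unfolding kvec_def by (intro sum.mono_neutral_left) auto

lemma kvec_pairing: "kvec c x = cnj (pairing c (\<lambda>y. k y x))"
  unfolding kvec_def pairing_def cnj_sum complex_cnj_mult
  by (intro sum.cong) (auto simp: hermitian[of x])

lemma kvec_add: "finsupp c \<Longrightarrow> finsupp d \<Longrightarrow> kvec (c + d) = kvec c + kvec d"
  by (simp add: fun_eq_iff kvec_pairing pairing_add_left)

lemma kvec_scale: "kvec (scale_fun a c) = scale_fun a (kvec c)"
  by (simp add: fun_eq_iff kvec_pairing pairing_scale_left) (simp add: scale_fun_def kvec_pairing)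

lemma kvec_diff: "finsupp c \<Longrightarrow> finsupp d \<Longrightarrow> kvec (c - d) = kvec c - kvec d"
  by (simp add: fun_eq_iff kvec_pairing pairing_diff_left)

lemma kvec_zero: "kvec 0 = 0"
  by (simp add: kvec_def fun_eq_iff)

lemma kvec_delta: "kvec (\<lambda>y. if y = x then 1 else 0) = (\<lambda>y. k y x)"
  by (simp add: kvec_def fun_eq_iff)

lemmas kvec_simps = kvec_add kvec_scale kvec_diff kvec_zero

lemma pairing_kvec_commute:
  assumes "finsupp c" "finsupp d"
  shows "pairing c (kvec d) = cnj (pairing d (kvec c))"
proof -
  define F where "F = {x. c x \<noteq> 0} \<union> {x. d x \<noteq> 0}"
  have F: "finite F" "{x. c x \<noteq> 0} \<subseteq> F" "{x. d x \<noteq> 0} \<subseteq> F" using assms by (auto simp: F_def)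
  have "pairing c (kvec d) = (\<Sum>x\<in>F. \<Sum>y\<in>F. cnj (c x) * d y * k x y)"
    by (simp add: pairing_superset[OF F(1,2)] kvec_superset[OF F(1,3)] sum_distrib_left mult.assoc)
  also have "\<dots> = (\<Sum>y\<in>F. \<Sum>x\<in>F. cnj (c x) * d y * cnj (k y x))"
    using hermitian by (subst sum.swap) (metis (no_types, lifting) sum.cong)
  also have "\<dots> = cnj (pairing d (kvec c))"
    by (simp add: pairing_superset[OF F(1,3)] kvec_superset[OF F(1,2)] sum_distrib_left mult_ac)
  finally show ?thesis .
qed

lemma Re_pairing_kvec_commute:
  "finsupp c \<Longrightarrow> finsupp d \<Longrightarrow> Re (pairing d (kvec c)) = Re (pairing c (kvec d))"
  using pairing_kvec_commute[of c d] by simp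

lemma pairing_kvec_nonneg: "finsupp c \<Longrightarrow> 0 \<le> Re (pairing c (kvec c))"
  using psd[of "{x. c x \<noteq> 0}" c]
  by (simp add: pairing_def kvec_def sum_distrib_left mult.assoc)

text \<open>The kernel defines a seminorm on the finitely supported families \<open>c\<close>, with square
  \<open>pairing c (kvec c)\<close>.  Optimising over the scalar multiples of each family shows that the supremum of
  \<open>dual_gap f\<close> is the squared dual norm of the antilinear functional \<open>c \<mapsto> pairing c f\<close>.\<close>
definition dual_gap :: "('x \<Rightarrow> complex) \<Rightarrow> ('x \<Rightarrow> complex) \<Rightarrow> real" where
  "dual_gap f c = 2 * Re (pairing c f) - Re (pairing c (kvec c))"

definition space :: "('x \<Rightarrow> complex) set" where
  "space = {f. bdd_above (dual_gap f ` {c. finsupp c})}"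

definition sqnorm :: "('x \<Rightarrow> complex) \<Rightarrow> real" where
  "sqnorm f = (SUP c\<in>{c. finsupp c}. dual_gap f c)"

lemma dual_gap_le: "f \<in> space \<Longrightarrow> finsupp c \<Longrightarrow> dual_gap f c \<le> sqnorm f"
  unfolding sqnorm_def space_def by (intro cSUP_upper) auto

lemma spaceI: "(\<And>c. finsupp c \<Longrightarrow> dual_gap f c \<le> B) \<Longrightarrow> f \<in> space"
  unfolding space_def by (auto intro!: bdd_aboveI2)

lemma sqnorm_le: "(\<And>c. finsupp c \<Longrightarrow> dual_gap f c \<le> B) \<Longrightarrow> sqnorm f \<le> B"
  unfolding sqnorm_def using finsupp_zero by (intro cSUP_least) blast+

lemma dual_gap_zero_right: "dual_gap f 0 = 0"
  by (simp add: dual_gap_def pairing_zero_left)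

lemma sqnorm_nonneg: "f \<in> space \<Longrightarrow> 0 \<le> sqnorm f"
  using dual_gap_le[of f 0] finsupp_zero by (simp add: dual_gap_zero_right)

lemma zero_in_space: "0 \<in> space" and sqnorm_zero: "sqnorm 0 = 0"
proof -
  have le: "dual_gap 0 c \<le> 0" if "finsupp c" for c
    using pairing_kvec_nonneg[OF that] by (simp add: dual_gap_def pairing_zero_right)
  show "0 \<in> space" using spaceI[OF le] by blast
  then show "sqnorm 0 = 0" using sqnorm_le[OF le] sqnorm_nonneg by force
qed

lemma dual_gap_weighted_parallelogram:
  assumes "finsupp c" "finsupp d"
  shows "dual_gap (f + scale_fun (of_real t) g) (c + scale_fun (of_real t) d) + t * dual_gap (f - g) (c - d)
    = (1 + t) * (dual_gap f c + t * dual_gap g d)"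
  using assms Re_pairing_kvec_commute[OF assms]
  by (simp add: dual_gap_def pairing_simps kvec_simps finsupps algebra_simps)

text \<open>The substitution \<open>u = c + t d\<close>, \<open>v = c - d\<close> permutes the pairs of families, so a weighted
  parallelogram law passes from the functions \<open>dual_gap f\<close> to their suprema.\<close>
lemma weighted_parallelogram:
  fixes t :: real
  assumes f: "f \<in> space" and g: "g \<in> space" and t: "t > 0"
  shows "f + scale_fun (of_real t) g \<in> space" "f - g \<in> space"
    and "sqnorm (f + scale_fun (of_real t) g) + t * sqnorm (f - g)
      = (1 + t) * (sqnorm f + t * sqnorm g)"
proof -
  let ?p = "f + scale_fun (of_real t) g" and ?m = "f - g"
  define B where "B = (1 + t) * (sqnorm f + t * sqnorm g)"
  have up: "dual_gap ?p u + t * dual_gap ?m v \<le> B" if uv: "finsupp u" "finsupp v" for u v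
  proof -
    define c where "c = scale_fun (of_real (1 / (1 + t))) (u + scale_fun (of_real t) v)"
    define d where "d = scale_fun (of_real (1 / (1 + t))) (u - v)"
    have cd: "finsupp c" "finsupp d" using uv by (auto simp only: c_def d_def intro!: finsupps)
    define a where "a = complex_of_real (1 / (1 + t))"
    have "a * (1 + of_real t) = of_real ((1 / (1 + t)) * (1 + t))"
      by (simp only: a_def of_real_mult of_real_add of_real_1)
    also have "(1 / (1 + t)) * (1 + t) = 1" using t by simp
    finally have a: "a * (1 + of_real t) = 1" by simp
    have "c + scale_fun (of_real t) d = u"
    proof
      fix x
      have "(c + scale_fun (of_real t) d) x = (a * (1 + of_real t)) * u x"
        unfolding c_def d_def a_def[symmetric] by (simp add: scale_fun_def algebra_simps)
      then show "(c + scale_fun (of_real t) d) x = u x" using a by simp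
    qed
    moreover have "c - d = v"
    proof
      fix x
      have "(c - d) x = (a * (1 + of_real t)) * v x"
        unfolding c_def d_def a_def[symmetric] by (simp add: scale_fun_def algebra_simps)
      then show "(c - d) x = v x" using a by simp
    qed
    ultimately have "dual_gap ?p u + t * dual_gap ?m v = (1 + t) * (dual_gap f c + t * dual_gap g d)"
      using dual_gap_weighted_parallelogram[OF cd] by metis
    also have "\<dots> \<le> B"
      unfolding B_def using t cd f g by (intro mult_left_mono add_mono dual_gap_le) auto
    finally show ?thesis .
  qed
  have "dual_gap ?p u \<le> B" if "finsupp u" for u
    using up[of u 0] that finsupp_zero by (simp add: dual_gap_zero_right)
  then show p: "?p \<in> space" by (rule spaceI)
  have "dual_gap ?m v \<le> B / t" if "finsupp v" for v
    using up[of 0 v] that finsupp_zero t by (simp add: dual_gap_zero_right field_simps)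
  then show m: "?m \<in> space" by (rule spaceI)
  have "sqnorm ?p \<le> B - t * dual_gap ?m v" if "finsupp v" for v
    using up[OF _ that] by (intro sqnorm_le) (simp add: algebra_simps)
  then have "dual_gap ?m v \<le> (B - sqnorm ?p) / t" if "finsupp v" for v
    using that t by (force simp: field_simps)
  then have le: "sqnorm ?p + t * sqnorm ?m \<le> B"
    using sqnorm_le[of ?m "(B - sqnorm ?p) / t"] t by (simp add: field_simps)
  define D where "D = (sqnorm ?p + t * sqnorm ?m) / (1 + t)"
  have down: "dual_gap f c + t * dual_gap g d \<le> D" if cd: "finsupp c" "finsupp d" for c d
  proof -
    have "(1 + t) * (dual_gap f c + t * dual_gap g d) \<le> sqnorm ?p + t * sqnorm ?m"
      unfolding dual_gap_weighted_parallelogram[OF cd, symmetric] using t cd p m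
      by (intro add_mono mult_left_mono dual_gap_le finsupps) auto
    then show ?thesis using t by (simp add: D_def field_simps)
  qed
  have "sqnorm f \<le> D - t * dual_gap g d" if "finsupp d" for d
    using down[OF _ that] by (intro sqnorm_le) (simp add: algebra_simps)
  then have "dual_gap g d \<le> (D - sqnorm f) / t" if "finsupp d" for d
    using that t by (force simp: field_simps)
  then have "sqnorm f + t * sqnorm g \<le> D"
    using sqnorm_le[of g "(D - sqnorm f) / t"] t by (simp add: field_simps)
  then have "B \<le> sqnorm ?p + t * sqnorm ?m"
    using t by (simp add: B_def D_def field_simps)
  with le show "sqnorm ?p + t * sqnorm ?m = (1 + t) * (sqnorm f + t * sqnorm g)"
    by (simp add: B_def)
qed

lemma scale_one: "scale_fun 1 f = f" and scale_zero: "scale_fun 0 f = 0"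
  and scale_scale: "scale_fun a (scale_fun b f) = scale_fun (a * b) f"
  by (auto simp: scale_fun_def fun_eq_iff)

lemma scale_in_space: "f \<in> space \<Longrightarrow> scale_fun a f \<in> space"
  and sqnorm_scale: "f \<in> space \<Longrightarrow> sqnorm (scale_fun a f) = (cmod a)\<^sup>2 * sqnorm f"
proof -
  have le: "dual_gap (scale_fun a f) c \<le> (cmod a)\<^sup>2 * sqnorm f"
    if a: "a \<noteq> 0" and f: "f \<in> space" and c: "finsupp c" for a f c
  proof -
    define d where "d = scale_fun (1 / a) c"
    have d: "finsupp d" using finsupp_scale[OF c] by (simp add: d_def)
    have c_eq: "c = scale_fun a d" using a by (simp add: d_def scale_scale scale_one)
    have aa: "Re (cnj a * (a * z)) = (cmod a)\<^sup>2 * Re z" "Re (a * (cnj a * z)) = (cmod a)\<^sup>2 * Re z" for z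
      by (simp add: cmod_power2 power2_eq_square[of "Re a"] power2_eq_square[of "Im a"] algebra_simps)+
    have "dual_gap (scale_fun a f) c = (cmod a)\<^sup>2 * dual_gap f d"
      unfolding c_eq dual_gap_def kvec_scale pairing_scale_left pairing_scale_right aa
      by (simp add: algebra_simps)
    also have "\<dots> \<le> (cmod a)\<^sup>2 * sqnorm f" using dual_gap_le[OF f d] by (intro mult_left_mono) auto
    finally show ?thesis .
  qed
  have mem: "scale_fun a f \<in> space" if "f \<in> space" for f a
    using spaceI[OF le[OF _ that]] zero_in_space by (cases "a = 0") (auto simp: scale_zero)
  then show "f \<in> space \<Longrightarrow> scale_fun a f \<in> space" .
  assume f: "f \<in> space"
  show "sqnorm (scale_fun a f) = (cmod a)\<^sup>2 * sqnorm f"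
  proof (cases "a = 0")
    case False
    have "sqnorm (scale_fun a f) \<le> (cmod a)\<^sup>2 * sqnorm f"
      using sqnorm_le[OF le[OF False f]] .
    moreover have "sqnorm f \<le> (cmod (1 / a))\<^sup>2 * sqnorm (scale_fun a f)"
      using sqnorm_le[OF le[of "1 / a", OF _ mem[OF f, of a]]] False
      by (simp add: scale_scale scale_one)
    ultimately show ?thesis using False by (simp add: norm_divide field_simps)
  qed (simp add: scale_zero sqnorm_zero)
qed

lemma diff_in_space: "f \<in> space \<Longrightarrow> g \<in> space \<Longrightarrow> f - g \<in> space"
  using weighted_parallelogram(2)[of f g 1] by simp

lemma add_in_space: "f \<in> space \<Longrightarrow> g \<in> space \<Longrightarrow> f + g \<in> space"
  using weighted_parallelogram(1)[of f g 1] by (simp add: scale_one)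

lemma sqnorm_minus_commute:
  assumes "f \<in> space" "g \<in> space"
  shows "sqnorm (f - g) = sqnorm (g - f)"
proof -
  have "g - f = scale_fun (-1) (f - g)" by (simp add: scale_fun_def fun_eq_iff)
  then show ?thesis using sqnorm_scale[OF diff_in_space[OF assms], of "-1"] by simp
qed

definition re_inner :: "('x \<Rightarrow> complex) \<Rightarrow> ('x \<Rightarrow> complex) \<Rightarrow> real" where
  "re_inner f g = (sqnorm f + sqnorm g - sqnorm (f - g)) / 2"

lemma re_inner_commute: "f \<in> space \<Longrightarrow> g \<in> space \<Longrightarrow> re_inner f g = re_inner g f"
  by (simp add: re_inner_def sqnorm_minus_commute)

text \<open>The parallelogram law with weight \<open>t\<close> expresses the squared norm of \<open>f + t g\<close> through that of \<open>f - g\<close>.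
  Hence \<open>t \<mapsto> sqnorm (f + t g)\<close> is a quadratic polynomial, and \<open>re_inner\<close> is homogeneous for all real
  factors at once, where the ordinary parallelogram law would give rational ones.\<close>
lemma sqnorm_add_scale:
  fixes t :: real
  assumes f: "f \<in> space" and g: "g \<in> space"
  shows "sqnorm (f + scale_fun (of_real t) g) = sqnorm f + t\<^sup>2 * sqnorm g + 2 * t * re_inner f g"
proof -
  have pos: "sqnorm (f + scale_fun (of_real t) g) = sqnorm f + t\<^sup>2 * sqnorm g + 2 * t * re_inner f g"
    if t: "t > 0" and g: "g \<in> space" for t g
  proof -
    have "2 * t * re_inner f g = t * (sqnorm f + sqnorm g - sqnorm (f - g))"
      by (simp add: re_inner_def)
    then show ?thesis
      using weighted_parallelogram(3)[OF f g t] by (simp add: algebra_simps power2_eq_square)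
  qed
  consider "t > 0" | "t = 0" | "t < 0" by linarith
  then show ?thesis
  proof cases
    case 3
    let ?g = "scale_fun (-1) g"
    have g': "?g \<in> space" "sqnorm ?g = sqnorm g" using scale_in_space sqnorm_scale g by auto
    have "sqnorm (f - ?g) = sqnorm f + sqnorm g + 2 * re_inner f g"
      using pos[of 1 g] g by (simp add: scale_one diff_scale_fun[of f ?g] scale_scale)
    then have neg: "re_inner f ?g = - re_inner f g" using g' by (simp add: re_inner_def)
    show ?thesis
      using pos[of "- t" ?g] 3 g' by (simp add: scale_scale neg)
  qed (use pos g in \<open>auto simp: scale_zero\<close>)
qed

lemma re_inner_scale:
  fixes t :: real
  assumes f: "f \<in> space" and g: "g \<in> space"
  shows "re_inner f (scale_fun (of_real t) g) = t * re_inner f g"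
proof -
  have eq: "f - scale_fun (of_real t) g = f + scale_fun (of_real (- t)) g"
    by (simp add: scale_fun_def fun_eq_iff)
  show ?thesis
    unfolding re_inner_def[of f "scale_fun _ g"] eq sqnorm_add_scale[OF f g] sqnorm_scale[OF g]
    by simp
qed

text \<open>The argument of Jordan and von Neumann: the parallelogram law at \<open>f + (g + h)/2\<close> and at
  \<open>f - (g + h)/2\<close>, with increment \<open>(g - h)/2\<close>.\<close>
lemma re_inner_add:
  assumes f: "f \<in> space" and g: "g \<in> space" and h: "h \<in> space"
  shows "re_inner f (g + h) = re_inner f g + re_inner f h"
proof -
  define m where "m = scale_fun (of_real (1/2)) (g + h)"
  define w where "w = scale_fun (of_real (1/2)) (g - h)"
  have mw: "m \<in> space" "w \<in> space"
    unfolding m_def w_def using add_in_space diff_in_space scale_in_space g h by blast+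
  have polar: "4 * re_inner f u = sqnorm (f + u) - sqnorm (f - u)" if "u \<in> space" for u
    using sqnorm_add_scale[OF f that, of 1] sqnorm_add_scale[OF f that, of "-1"]
    by (simp add: scale_one diff_scale_fun[of f u])
  have para: "sqnorm (u + w) + sqnorm (u - w) = 2 * sqnorm u + 2 * sqnorm w" if "u \<in> space" for u
    using weighted_parallelogram(3)[OF that mw(2), of 1] by (simp add: scale_one)
  have eqs: "(f + m) + w = f + g" "(f + m) - w = f + h" "(f - m) + w = f - h" "(f - m) - w = f - g"
    by (auto simp: m_def w_def scale_fun_def fun_eq_iff field_simps)
  have "4 * re_inner f g + 4 * re_inner f h = 2 * sqnorm (f + m) - 2 * sqnorm (f - m)"
    using para[OF add_in_space[OF f mw(1)]] para[OF diff_in_space[OF f mw(1)]]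
    unfolding eqs polar[OF g] polar[OF h] by simp
  also have "\<dots> = 8 * re_inner f m" using polar[OF mw(1)] by simp
  also have "\<dots> = 4 * re_inner f (g + h)"
    unfolding m_def re_inner_scale[OF f add_in_space[OF g h]] by simp
  finally show ?thesis by simp
qed

lemma re_inner_rotate:
  assumes f: "f \<in> space" and g: "g \<in> space"
  shows "re_inner (scale_fun \<i> f) g = - re_inner f (scale_fun \<i> g)"
proof -
  have rot: "re_inner (scale_fun \<i> u) (scale_fun \<i> v) = re_inner u v" if "u \<in> space" "v \<in> space" for u v
  proof -
    have "scale_fun \<i> u - scale_fun \<i> v = scale_fun \<i> (u - v)"
      by (simp add: scale_fun_def fun_eq_iff algebra_simps)
    then show ?thesis
      using that diff_in_space[OF that] by (simp add: re_inner_def sqnorm_scale)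
  qed
  have "re_inner (scale_fun \<i> f) g = re_inner (scale_fun \<i> (scale_fun \<i> f)) (scale_fun \<i> g)"
    using rot[OF scale_in_space[OF f] g] by simp
  also have "scale_fun \<i> (scale_fun \<i> f) = scale_fun (of_real (-1)) f" by (simp add: scale_scale)
  finally show ?thesis
    using re_inner_scale[of "scale_fun \<i> g" f "-1"] f g scale_in_space
      re_inner_commute[of "scale_fun (of_real (-1)) f" "scale_fun \<i> g"]
      re_inner_commute[of f "scale_fun \<i> g"] by simp
qed

definition rkhs :: "('x \<Rightarrow> complex) hilbert" where
  "rkhs = \<lparr>hcarrier = space, hscale = scale_fun,
    hinner = (\<lambda>f g. Complex (re_inner f g) (- re_inner f (scale_fun \<i> g)))\<rparr>"

lemma rkhs_simps:
  "hcarrier rkhs = space" "hscale rkhs = scale_fun"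
  "hinner rkhs f g = Complex (re_inner f g) (- re_inner f (scale_fun \<i> g))"
  by (auto simp: rkhs_def)

lemma rkhs_inner_self:
  assumes f: "f \<in> space"
  shows "hinner rkhs f f = of_real (sqnorm f)"
proof -
  have "f - scale_fun \<i> f = scale_fun (1 - \<i>) f"
    by (simp add: scale_fun_def fun_eq_iff algebra_simps)
  moreover have "(cmod (1 - \<i>))\<^sup>2 = 2" by (simp add: cmod_power2)
  ultimately have "re_inner f (scale_fun \<i> f) = 0"
    by (simp add: re_inner_def sqnorm_scale[OF f])
  moreover have "re_inner f f = sqnorm f" by (simp add: re_inner_def sqnorm_zero)
  ultimately show ?thesis by (simp add: rkhs_simps complex_eq_iff)
qed

lemma sqnorm_eq_zero:
  assumes f: "f \<in> space" and zero: "sqnorm f = 0"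
  shows "f = 0"
proof
  fix x
  \<comment> \<open>test against a multiple of the point mass at x whose phase makes the pairing positive\<close>
  define p where "p = (if f x = 0 then 1 else f x / of_real (cmod (f x)))"
  define \<delta> where "\<delta> = (\<lambda>y. if y = x then 1 else 0 :: complex)"
  have \<delta>: "finsupp \<delta>" "pairing \<delta> g = g x" for g
    unfolding \<delta>_def by (rule finsupp_delta, rule pairing_delta)
  have p: "cnj p * f x = of_real (cmod (f x)) \<and> cnj p * p = 1"
  proof (cases "f x = 0")
    case False
    have sq: "cnj (f x) * f x = of_real (cmod (f x)) * of_real (cmod (f x))"
      using complex_norm_square[of "f x"] by (simp add: mult.commute power2_eq_square)
    have "cnj p * f x = (cnj (f x) * f x) / of_real (cmod (f x))"
      "cnj p * p = (cnj (f x) * f x) / (of_real (cmod (f x)) * of_real (cmod (f x)))"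
      using False by (auto simp: p_def)
    then show ?thesis unfolding sq using False by simp
  qed (simp add: p_def)
  have le: "2 * cmod (f x) \<le> t * Re (k x x)" if t: "t > 0" for t
  proof -
    have "dual_gap f (scale_fun (of_real t * p) \<delta>) \<le> 0"
      using dual_gap_le[OF f finsupp_scale[OF \<delta>(1)]] zero by simp
    moreover have "pairing (scale_fun (of_real t * p) \<delta>) f = of_real (t * cmod (f x))"
      using p by (simp add: pairing_scale_left \<delta>(2))
    moreover have "pairing (scale_fun (of_real t * p) \<delta>) (kvec (scale_fun (of_real t * p) \<delta>))
        = of_real (t * t) * (cnj p * p) * k x x"
      by (simp add: pairing_scale_left kvec_scale pairing_scale_right \<delta>(2))
        (simp add: \<delta>_def kvec_delta)
    ultimately have "2 * (t * cmod (f x)) \<le> t * t * Re (k x x)"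
      by (simp add: dual_gap_def p)
    then show ?thesis using t by (simp add: mult.assoc mult.left_commute)
  qed
  have "(\<lambda>n. inverse (real (Suc n)) * Re (k x x)) \<longlonglongrightarrow> 0 * Re (k x x)"
    by (intro tendsto_intros LIMSEQ_inverse_real_of_nat)
  then have "2 * cmod (f x) \<le> 0 * Re (k x x)"
    by (rule LIMSEQ_le_const) (use le in auto)
  then show "f x = 0 x" by simp
qed

lemma rkhs_inner_product_space: "complex_inner_product_space rkhs"
proof (intro complex_inner_product_space.intro complex_inner_product_space_axioms.intro;
    (unfold rkhs_simps(1,2))?)
  show "vector_space (scale_fun :: complex \<Rightarrow> ('x \<Rightarrow> complex) \<Rightarrow> _)"
    by (rule vector_space_scale_fun)
  then interpret vector_space "scale_fun :: complex \<Rightarrow> ('x \<Rightarrow> complex) \<Rightarrow> _" .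
  show "subspace space"
    using zero_in_space add_in_space scale_in_space by (intro subspaceI) auto
  show "hinner rkhs f g = cnj (hinner rkhs g f)" if "f \<in> space" "g \<in> space" for f g
    using that re_inner_rotate[OF that] re_inner_commute[OF that]
      re_inner_commute[OF scale_in_space[OF that(1)] that(2)]
    by (simp add: rkhs_simps complex_eq_iff)
  have ladd: "hinner rkhs f (g + h) = hinner rkhs f g + hinner rkhs f h"
    if "f \<in> space" "g \<in> space" "h \<in> space" for f g h
    using that scale_in_space by (simp add: rkhs_simps complex_eq_iff re_inner_add
        scale_right_distrib)
  then show "hinner rkhs f (g + h) = hinner rkhs f g + hinner rkhs f h"
    if "f \<in> space" "g \<in> space" "h \<in> space" for f g h using that by blast
  show "hinner rkhs f (scale_fun c g) = c * hinner rkhs f g"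
    if f: "f \<in> space" and g: "g \<in> space" for c f g
  proof -
    have real: "hinner rkhs f (scale_fun (of_real t) u) = of_real t * hinner rkhs f u"
      if u: "u \<in> space" for t u
    proof -
      have "scale_fun \<i> (scale_fun (of_real t) u) = scale_fun (of_real t) (scale_fun \<i> u)"
        by (simp add: scale_scale mult.commute)
      then show ?thesis
        unfolding rkhs_simps using re_inner_scale[OF f u] re_inner_scale[OF f scale_in_space[OF u]]
        by (simp add: complex_eq_iff mult.commute)
    qed
    have imag: "hinner rkhs f (scale_fun \<i> g) = \<i> * hinner rkhs f g"
      using re_inner_scale[OF f g, of "-1"] by (simp add: rkhs_simps complex_eq_iff scale_scale)
    have e: "scale_fun c g = scale_fun (of_real (Re c)) g + scale_fun (of_real (Im c)) (scale_fun \<i> g)"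
      by (simp add: scale_fun_def fun_eq_iff complex_eq_iff)
    note ig = scale_in_space[OF g, of \<i>]
    have "hinner rkhs f (scale_fun c g) = (of_real (Re c) + of_real (Im c) * \<i>) * hinner rkhs f g"
      by (subst e) (simp only: ladd[OF f scale_in_space[OF g] scale_in_space[OF ig]] real[OF g]
          real[OF ig] imag distrib_right mult.assoc)
    also have "of_real (Re c) + of_real (Im c) * \<i> = c" by (simp add: complex_eq_iff)
    finally show ?thesis .
  qed
  show "0 \<le> hinner rkhs f f" if "f \<in> space" for f
    using sqnorm_nonneg[OF that] by (simp add: rkhs_inner_self[OF that] less_eq_complex_def)
  show "f = 0" if "f \<in> space" "hinner rkhs f f = 0" for f
    using that sqnorm_eq_zero by (simp add: rkhs_inner_self)
qed

interpretation rkhs: complex_inner_product_space rkhs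
  by (rule rkhs_inner_product_space)

lemma rkhs_hnorm: "f \<in> space \<Longrightarrow> hnorm rkhs f = sqrt (sqnorm f)"
  by (simp add: hnorm_def rkhs_inner_self)

text \<open>Subtracting \<open>kvec c\<close> translates the family on which the gap is evaluated, so the squared norm
  drops by exactly \<open>dual_gap f c\<close>.  By polarisation this is the reproducing property.\<close>
lemma dual_gap_diff_kvec:
  "finsupp c \<Longrightarrow> finsupp d \<Longrightarrow> dual_gap (f - kvec c) d = dual_gap f (d + c) - dual_gap f c"
  using Re_pairing_kvec_commute[of c d]
  by (simp add: dual_gap_def pairing_simps kvec_simps algebra_simps)

lemma sqnorm_diff_kvec:
  assumes f: "f \<in> space" and c: "finsupp c"
  shows "f - kvec c \<in> space" "sqnorm (f - kvec c) = sqnorm f - dual_gap f c"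
proof -
  have le: "dual_gap (f - kvec c) d \<le> sqnorm f - dual_gap f c" if "finsupp d" for d
    using dual_gap_le[of f "d + c"] f finsupp_add[OF that c] by (simp add: dual_gap_diff_kvec[OF c that])
  show mem: "f - kvec c \<in> space" by (rule spaceI[OF le])
  have "dual_gap f d \<le> sqnorm (f - kvec c) + dual_gap f c" if "finsupp d" for d
    using dual_gap_le[OF mem, of "d - c"] dual_gap_diff_kvec[OF c, of "d - c" f] finsupp_diff[OF that c]
    by simp
  then show "sqnorm (f - kvec c) = sqnorm f - dual_gap f c"
    using sqnorm_le[OF le] sqnorm_le[of f "sqnorm (f - kvec c) + dual_gap f c"] by force
qed

lemma kvec_in_space:
  assumes "finsupp c"
  shows "kvec c \<in> space" "sqnorm (kvec c) = Re (pairing c (kvec c))"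
proof -
  have eq: "kvec c = 0 - kvec (scale_fun (-1) c)"
    unfolding kvec_scale by (simp add: scale_fun_def fun_eq_iff)
  note d = sqnorm_diff_kvec[OF zero_in_space finsupp_scale[OF assms], of "-1"]
  show "kvec c \<in> space" unfolding eq by (rule d)
  have "sqnorm (kvec c) = sqnorm (0 - kvec (scale_fun (-1) c))" using eq by simp
  then show "sqnorm (kvec c) = Re (pairing c (kvec c))"
    unfolding d(2) by (simp add: dual_gap_def sqnorm_zero pairing_simps kvec_scale)
qed

lemma inner_kvec:
  assumes f: "f \<in> space" and c: "finsupp c"
  shows "hinner rkhs (kvec c) f = pairing c f"
proof -
  have re: "re_inner f (kvec c) = Re (pairing c f)" if "finsupp c" for c
    using sqnorm_diff_kvec[OF f that] kvec_in_space[OF that]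
    by (simp add: re_inner_def dual_gap_def)
  have "hinner rkhs f (kvec c) = cnj (pairing c f)"
    unfolding rkhs_simps kvec_scale[symmetric] re[OF c] re[OF finsupp_scale[OF c]]
    by (simp add: pairing_scale_left complex_eq_iff)
  then show ?thesis
    using rkhs.hinner_commute[of "kvec c" f] f kvec_in_space[OF c] by (simp add: rkhs_simps(1))
qed

abbreviation point :: "'x \<Rightarrow> 'x \<Rightarrow> complex" where
  "point x \<equiv> \<lambda>y. k y x"

lemma point_in_space: "point x \<in> space"
  using kvec_in_space(1)[OF finsupp_delta] by (simp add: kvec_delta)

lemma reproducing: "f \<in> space \<Longrightarrow> hinner rkhs (point x) f = f x"
  using inner_kvec[OF _ finsupp_delta] by (simp add: kvec_delta pairing_delta)

lemma cmod_point_le: "f \<in> space \<Longrightarrow> cmod (f x) \<le> hnorm rkhs (point x) * hnorm rkhs f"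
  using rkhs.cmod_hinner_le[of "point x" f] by (simp add: reproducing rkhs_simps(1) point_in_space)

text \<open>A Cauchy sequence converges pointwise, since evaluation is bounded, and the squared norm is
  lower semicontinuous under pointwise limits, being a supremum of the pointwise continuous
  functions \<open>f \<mapsto> dual_gap f c\<close>.\<close>
theorem rkhs_hilbert: "complex_hilbert_space rkhs"
proof (intro complex_hilbert_space.intro complex_hilbert_space_axioms.intro rkhs_inner_product_space)
  show "Metric_space.mcomplete (hcarrier rkhs) (hdist rkhs)"
    unfolding rkhs.mcomplete_iff unfolding rkhs_simps(1)
  proof (intro allI impI)
    fix \<sigma> :: "nat \<Rightarrow> 'x \<Rightarrow> complex"
    assume "\<forall>n. \<sigma> n \<in> space"
      and cauchy: "\<forall>e>0. \<exists>N. \<forall>n\<ge>N. \<forall>m\<ge>N. hnorm rkhs (\<sigma> n - \<sigma> m) < e"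
    then have \<sigma>: "\<sigma> n \<in> space" for n by blast
    have "Cauchy (\<lambda>n. \<sigma> n x)" for x
    proof (rule CauchyI)
      fix e :: real assume e: "e > 0"
      let ?K = "hnorm rkhs (point x) + 1"
      have K: "?K > 0" "hnorm rkhs (point x) \<le> ?K"
        using rkhs.hnorm_nonneg[of "point x"] point_in_space by (auto simp: rkhs_simps(1) add_nonneg_pos)
      obtain N where N: "\<And>n m. n \<ge> N \<Longrightarrow> m \<ge> N \<Longrightarrow> hnorm rkhs (\<sigma> n - \<sigma> m) < e / ?K"
        using cauchy e K by (meson divide_pos_pos)
      have "norm (\<sigma> m x - \<sigma> n x) < e" if "m \<ge> N" "n \<ge> N" for m n
      proof -
        have d: "\<sigma> m - \<sigma> n \<in> space" using diff_in_space \<sigma> by blast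
        have "norm (\<sigma> m x - \<sigma> n x) \<le> hnorm rkhs (point x) * hnorm rkhs (\<sigma> m - \<sigma> n)"
          using cmod_point_le[OF d, of x] by simp
        also have "\<dots> \<le> ?K * hnorm rkhs (\<sigma> m - \<sigma> n)"
          using rkhs.hnorm_nonneg[of "\<sigma> m - \<sigma> n"] d by (intro mult_right_mono) (auto simp: rkhs_simps(1))
        also have "\<dots> < e" using N[OF that] K(1) by (simp add: pos_less_divide_eq mult.commute)
        finally show ?thesis .
      qed
      then show "\<exists>N. \<forall>m\<ge>N. \<forall>n\<ge>N. norm (\<sigma> m x - \<sigma> n x) < e" by blast
    qed
    then have "\<forall>x. \<exists>l. (\<lambda>n. \<sigma> n x) \<longlonglongrightarrow> l" by (simp add: Cauchy_convergent_iff convergent_def)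
    then obtain f where f: "\<And>x. (\<lambda>n. \<sigma> n x) \<longlonglongrightarrow> f x" by metis
    have close: "\<sigma> n - f \<in> space \<and> sqnorm (\<sigma> n - f) \<le> e\<^sup>2"
      if N: "\<And>m. m \<ge> N \<Longrightarrow> hnorm rkhs (\<sigma> n - \<sigma> m) < e" for n N e
    proof -
      have "dual_gap (\<sigma> n - f) c \<le> e\<^sup>2" if c: "finsupp c" for c
      proof (rule LIMSEQ_le_const2)
        show "(\<lambda>m. dual_gap (\<sigma> n - \<sigma> m) c) \<longlonglongrightarrow> dual_gap (\<sigma> n - f) c"
          unfolding dual_gap_def pairing_def fun_diff_def by (intro tendsto_intros f)
        have "dual_gap (\<sigma> n - \<sigma> m) c \<le> e\<^sup>2" if m: "m \<ge> N" for m
        proof -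
          have d: "\<sigma> n - \<sigma> m \<in> space" using diff_in_space \<sigma> by blast
          have "sqnorm (\<sigma> n - \<sigma> m) = (hnorm rkhs (\<sigma> n - \<sigma> m))\<^sup>2"
            using sqnorm_nonneg[OF d] by (simp add: rkhs_hnorm[OF d])
          also have "\<dots> \<le> e\<^sup>2"
            using N[OF m] rkhs.hnorm_nonneg[of "\<sigma> n - \<sigma> m"] d
            by (intro power_mono) (auto simp: rkhs_simps(1))
          finally show ?thesis using dual_gap_le[OF d c] by simp
        qed
        then show "\<exists>N. \<forall>m\<ge>N. dual_gap (\<sigma> n - \<sigma> m) c \<le> e\<^sup>2" by blast
      qed
      then show ?thesis using spaceI sqnorm_le by blast
    qed
    have fs: "f \<in> space"
    proof -
      obtain N where "\<And>m. m \<ge> N \<Longrightarrow> hnorm rkhs (\<sigma> N - \<sigma> m) < 1" using cauchy by (meson zero_less_one order_refl)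
      then have "\<sigma> N - f \<in> space" using close by blast
      then have "\<sigma> N - (\<sigma> N - f) \<in> space" using diff_in_space \<sigma> by blast
      then show ?thesis by simp
    qed
    have "(\<lambda>n. hnorm rkhs (\<sigma> n - f)) \<longlonglongrightarrow> 0"
    proof (rule LIMSEQ_I)
      fix e :: real assume e: "e > 0"
      obtain N where N: "\<And>n m. n \<ge> N \<Longrightarrow> m \<ge> N \<Longrightarrow> hnorm rkhs (\<sigma> n - \<sigma> m) < e / 2"
        using cauchy e by (meson half_gt_zero)
      have "norm (hnorm rkhs (\<sigma> n - f) - 0) < e" if "n \<ge> N" for n
      proof -
        have c: "\<sigma> n - f \<in> space" "sqnorm (\<sigma> n - f) \<le> (e / 2)\<^sup>2"
          using close[of N n "e / 2"] N that by auto
        have "sqrt (sqnorm (\<sigma> n - f)) \<le> sqrt ((e / 2)\<^sup>2)"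
          using c(2) real_sqrt_le_mono by blast
        then have "sqrt (sqnorm (\<sigma> n - f)) \<le> e / 2" using e by simp
        then show ?thesis using e sqnorm_nonneg[OF c(1)] by (simp add: rkhs_hnorm[OF c(1)])
      qed
      then show "\<exists>N. \<forall>n\<ge>N. norm (hnorm rkhs (\<sigma> n - f) - 0) < e" by blast
    qed
    with fs show "\<exists>x\<in>space. (\<lambda>n. hnorm rkhs (\<sigma> n - x)) \<longlonglongrightarrow> 0" by blast
  qed
qed

text \<open>Composition with \<open>\<tau>\<close> only permutes the families over which the supremum is taken.\<close>
lemma composition_isometry:
  assumes \<tau>: "bij \<tau>" and inv: "\<And>x y. k (\<tau> x) (\<tau> y) = k x y"
  shows "f \<in> space \<Longrightarrow> f \<circ> \<tau> \<in> space"
    and "f \<in> space \<Longrightarrow> g \<in> space \<Longrightarrow> hinner rkhs (f \<circ> \<tau>) (g \<circ> \<tau>) = hinner rkhs f g"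
proof -
  have supp: "bij_betw \<tau> {x. (c \<circ> \<tau>) x \<noteq> 0} {x. c x \<noteq> 0}" for c :: "'x \<Rightarrow> complex"
    using \<tau> unfolding bij_betw_def bij_def by (auto intro: inj_on_subset)
  have fin: "finsupp (c \<circ> \<tau>) \<longleftrightarrow> finsupp c" for c :: "'x \<Rightarrow> complex"
    using bij_betw_finite[OF supp] .
  have pair: "pairing (c \<circ> \<tau>) (f \<circ> \<tau>) = pairing c f" for c f
    unfolding pairing_def using sum.reindex_bij_betw[OF supp[of c], of "\<lambda>x. cnj (c x) * f x"] by simp
  have kv: "kvec (c \<circ> \<tau>) = kvec c \<circ> \<tau>" for c
  proof
    fix x
    show "kvec (c \<circ> \<tau>) x = (kvec c \<circ> \<tau>) x"
      unfolding kvec_def using sum.reindex_bij_betw[OF supp[of c], of "\<lambda>y. c y * k (\<tau> x) y"]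
      by (simp add: inv)
  qed
  have gap: "dual_gap (f \<circ> \<tau>) (c \<circ> \<tau>) = dual_gap f c" for f c
    by (simp add: dual_gap_def pair kv)
  have img: "(\<lambda>c. c \<circ> \<tau>) ` {c. finsupp c} = {c :: 'x \<Rightarrow> complex. finsupp c}"
  proof (intro equalityI subsetI)
    fix c :: "'x \<Rightarrow> complex" assume c: "c \<in> {c. finsupp c}"
    have c_eq: "c = (c \<circ> inv \<tau>) \<circ> \<tau>" using \<tau> by (simp add: fun_eq_iff bij_is_inj)
    have "finsupp ((c \<circ> inv \<tau>) \<circ> \<tau>)" using c c_eq[symmetric] by simp
    then have "c \<circ> inv \<tau> \<in> {c. finsupp c}" unfolding fin by blast
    with c_eq show "c \<in> (\<lambda>c. c \<circ> \<tau>) ` {c. finsupp c}" by (rule image_eqI)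
  next
    fix c :: "'x \<Rightarrow> complex" assume "c \<in> (\<lambda>c. c \<circ> \<tau>) ` {c. finsupp c}"
    then obtain d where "finsupp d" "c = d \<circ> \<tau>" by blast
    then show "c \<in> {c. finsupp c}" using fin[of d] by blast
  qed
  have gaps: "dual_gap (f \<circ> \<tau>) ` {c. finsupp c} = dual_gap f ` {c. finsupp c}" for f
    by (subst img[symmetric]) (simp add: image_image gap)
  show "f \<in> space \<Longrightarrow> f \<circ> \<tau> \<in> space" by (simp add: space_def gaps)
  have sq: "sqnorm (f \<circ> \<tau>) = sqnorm f" for f by (simp add: sqnorm_def gaps)
  have "re_inner (f \<circ> \<tau>) (g \<circ> \<tau>) = re_inner f g" for f g
  proof -
    have "(f \<circ> \<tau>) - (g \<circ> \<tau>) = (f - g) \<circ> \<tau>" by (simp add: fun_eq_iff)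
    then show ?thesis by (simp add: re_inner_def sq)
  qed
  moreover have "scale_fun a g \<circ> \<tau> = scale_fun a (g \<circ> \<tau>)" for a g by (simp add: scale_fun_def fun_eq_iff)
  ultimately show "hinner rkhs (f \<circ> \<tau>) (g \<circ> \<tau>) = hinner rkhs f g"
    by (metis rkhs_simps(3))
qed

end

section \<open>Moments of a random operator\<close>

text \<open>The functions into \<open>H\<close> obtained from simple functions by iterated pointwise limits.  Strongly
  measurable functions are limits of this kind, and since the class is closed under limits by
  construction, its stability under a random operator and the measurability of inner products of
  its members follow by induction.\<close>
inductive limit_measurable ::
  "'w measure \<Rightarrow> 'h::ab_group_add hilbert \<Rightarrow> ('w \<Rightarrow> 'h) \<Rightarrow> bool" for M H where
  simple: "simple_function M s \<Longrightarrow> (\<And>\<omega>. \<omega> \<in> space M \<Longrightarrow> s \<omega> \<in> hcarrier H) \<Longrightarrow> limit_measurable M H s"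
| limit: "(\<And>i::nat. limit_measurable M H (s i)) \<Longrightarrow> (\<And>\<omega>. \<omega> \<in> space M \<Longrightarrow> f \<omega> \<in> hcarrier H) \<Longrightarrow>
    (\<And>\<omega>. \<omega> \<in> space M \<Longrightarrow> (\<lambda>i. hnorm H (s i \<omega> - f \<omega>)) \<longlonglongrightarrow> 0) \<Longrightarrow> limit_measurable M H f"

lemma limit_measurable_carrier:
  "limit_measurable M H f \<Longrightarrow> \<omega> \<in> space M \<Longrightarrow> f \<omega> \<in> hcarrier H"
  by (induction rule: limit_measurable.induct) auto

lemma (in complex_inner_product_space) borel_measurable_hinner:
  assumes f: "limit_measurable M V f" and g: "limit_measurable M V g"
  shows "(\<lambda>\<omega>. hinner V (f \<omega>) (g \<omega>)) \<in> borel_measurable M"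
  using f
proof (induction rule: limit_measurable.induct)
  case (simple s)
  from g show ?case
  proof (induction rule: limit_measurable.induct)
    case t: (simple t)
    show ?case
      using simple_function_compose2[OF simple(1) t(1), of "hinner V"]
      by (rule borel_measurable_simple_function)
  next
    case (limit t g)
    show ?case
    proof (rule borel_measurable_LIMSEQ_metric)
      show "(\<lambda>i. hinner V (s \<omega>) (t i \<omega>)) \<longlonglongrightarrow> hinner V (s \<omega>) (g \<omega>)" if "\<omega> \<in> space M" for \<omega>
        using that simple(2) limit limit_measurable_carrier[OF limit(1) that]
          hinner_zero_right[OF carrier_zero]
        by (intro tendsto_hinner) (auto simp: hnorm_def)
    qed (use limit in auto)
  qed
next
  case (limit s f)
  show ?case
  proof (rule borel_measurable_LIMSEQ_metric)
    show "(\<lambda>i. hinner V (s i \<omega>) (g \<omega>)) \<longlonglongrightarrow> hinner V (f \<omega>) (g \<omega>)" if "\<omega> \<in> space M" for \<omega>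
      using that limit limit_measurable_carrier[OF g] limit_measurable_carrier[OF limit(1) that]
        hinner_zero_right[OF carrier_zero]
      by (intro tendsto_hinner) (auto simp: hnorm_def)
  qed (use limit in auto)
qed

locale random_operator_with_moments = complex_hilbert_space H
  for H :: "'h::ab_group_add hilbert" +
  fixes M :: "'w::topological_space measure" and A :: "'w \<Rightarrow> 'h \<Rightarrow> 'h"
  assumes prob: "prob_space M"
    and random: "random_operator M H A"
    and moments: "moments_exist M H A"
begin

lemma operator: "\<omega> \<in> space M \<Longrightarrow> bounded_operator H H (A \<omega>)"
  using random by (simp add: random_operator_def)

lemma operator_power: "\<omega> \<in> space M \<Longrightarrow> bounded_operator H H (A \<omega> ^^ n)"
  by (intro bounded_operator_funpow operator complex_inner_product_space_axioms)

lemmas power_carrier = bounded_operatorD(1)[OF operator_power]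
  and power_add = bounded_operatorD(2)[OF operator_power]
  and power_scale = bounded_operatorD(3)[OF operator_power]

lemma limit_measurable_apply:
  assumes "limit_measurable M H f"
  shows "limit_measurable M H (\<lambda>\<omega>. A \<omega> (f \<omega>))"
  using assms
proof (induction rule: limit_measurable.induct)
  case (simple s)
  \<comment> \<open>on the set where s has the value v, approximate by simple functions that converge to A v\<close>
  have "\<forall>v\<in>hcarrier H. \<exists>t :: nat \<Rightarrow> 'w \<Rightarrow> 'h. (\<forall>i. simple_function M (t i) \<and> t i \<in> space M \<rightarrow> hcarrier H) \<and>
      (\<forall>\<omega>\<in>space M. limitin (htopology H) (\<lambda>i. t i \<omega>) (A \<omega> v) sequentially)"
    using random by (auto simp: random_operator_def strongly_measurable_def)
  from bchoice[OF this] obtain t :: "'h \<Rightarrow> nat \<Rightarrow> 'w \<Rightarrow> 'h" where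
    T: "\<forall>v\<in>hcarrier H. (\<forall>i. simple_function M (t v i) \<and> t v i \<in> space M \<rightarrow> hcarrier H) \<and>
      (\<forall>\<omega>\<in>space M. limitin (htopology H) (\<lambda>i. t v i \<omega>) (A \<omega> v) sequentially)" by blast
  have t: "\<And>v i. v \<in> hcarrier H \<Longrightarrow> simple_function M (t v i)"
      "\<And>v i \<omega>. v \<in> hcarrier H \<Longrightarrow> \<omega> \<in> space M \<Longrightarrow> t v i \<omega> \<in> hcarrier H"
      "\<And>v \<omega>. v \<in> hcarrier H \<Longrightarrow> \<omega> \<in> space M \<Longrightarrow> limitin (htopology H) (\<lambda>i. t v i \<omega>) (A \<omega> v) sequentially"
    using T by blast+
  have fin: "finite (s ` space M)" using simple(1) by (rule simple_functionD)
  show ?case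
  proof (rule limit_measurable.limit[of M H "\<lambda>i \<omega>. t (s \<omega>) i \<omega>"])
    fix i
    have "simple_function M (\<lambda>\<omega>. t (s \<omega>) i \<omega>)"
      unfolding simple_function_def
    proof (intro conjI ballI)
      have "(\<lambda>\<omega>. t (s \<omega>) i \<omega>) ` space M \<subseteq> (\<Union>v\<in>s ` space M. t v i ` space M)" by auto
      moreover have "finite (\<Union>v\<in>s ` space M. t v i ` space M)"
        using simple(2) t(1) by (intro finite_UN_I[OF fin] simple_functionD(1)) auto
      ultimately show "finite ((\<lambda>\<omega>. t (s \<omega>) i \<omega>) ` space M)" by (rule finite_subset)
      fix x
      have "(\<lambda>\<omega>. t (s \<omega>) i \<omega>) -` {x} \<inter> space M =
          (\<Union>v\<in>s ` space M. (s -` {v} \<inter> space M) \<inter> (t v i -` {x} \<inter> space M))" by auto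
      also have "\<dots> \<in> sets M"
        using simple(2) by (intro sets.finite_UN fin sets.Int simple_functionD(2)[OF simple(1)]
            simple_functionD(2)[OF t(1)]) auto
      finally show "(\<lambda>\<omega>. t (s \<omega>) i \<omega>) -` {x} \<inter> space M \<in> sets M" .
    qed
    then show "limit_measurable M H (\<lambda>\<omega>. t (s \<omega>) i \<omega>)"
      using simple(2) t(2) by (intro limit_measurable.simple) auto
  qed (use simple(2) t(3) in \<open>auto simp: limitin_htopology_iff\<close>)
next
  case (limit s f)
  show ?case
  proof (rule limit_measurable.limit[of M H "\<lambda>i \<omega>. A \<omega> (s i \<omega>)"])
    fix \<omega> assume \<omega>: "\<omega> \<in> space M"
    show "A \<omega> (f \<omega>) \<in> hcarrier H" using bounded_operatorD(1)[OF operator[OF \<omega>]] limit(2) \<omega> by blast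
    show "(\<lambda>i. hnorm H (A \<omega> (s i \<omega>) - A \<omega> (f \<omega>))) \<longlonglongrightarrow> 0"
      using limit(2,3)[OF \<omega>] limit_measurable_carrier[OF limit(1) \<omega>]
      by (intro bounded_operator_tendsto[OF complex_inner_product_space_axioms operator[OF \<omega>]])
  qed (use limit in auto)
qed

lemma limit_measurable_power: "a \<in> hcarrier H \<Longrightarrow> limit_measurable M H (\<lambda>\<omega>. (A \<omega> ^^ n) a)"
proof (induction n)
  case 0
  then show ?case by (auto intro: limit_measurable.simple)
next
  case (Suc n)
  then show ?case using limit_measurable_apply by simp
qed

lemma integrable_power2: "a \<in> hcarrier H \<Longrightarrow> integrable M (\<lambda>\<omega>. (hnorm H ((A \<omega> ^^ n) a))\<^sup>2)"
  using moments by (simp add: moments_exist_def)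

lemma integrable_moment:
  assumes "a \<in> hcarrier H" "b \<in> hcarrier H"
  shows "integrable M (\<lambda>\<omega>. hinner H ((A \<omega> ^^ m) a) ((A \<omega> ^^ n) b))"
proof (rule Bochner_Integration.integrable_bound)
  show "integrable M (\<lambda>\<omega>. (hnorm H ((A \<omega> ^^ m) a))\<^sup>2 + (hnorm H ((A \<omega> ^^ n) b))\<^sup>2)"
    using assms by (intro Bochner_Integration.integrable_add integrable_power2)
  show "(\<lambda>\<omega>. hinner H ((A \<omega> ^^ m) a) ((A \<omega> ^^ n) b)) \<in> borel_measurable M"
    using assms by (intro borel_measurable_hinner limit_measurable_power)
  show "AE \<omega> in M. norm (hinner H ((A \<omega> ^^ m) a) ((A \<omega> ^^ n) b))
      \<le> norm ((hnorm H ((A \<omega> ^^ m) a))\<^sup>2 + (hnorm H ((A \<omega> ^^ n) b))\<^sup>2)"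
  proof (rule AE_I2)
    fix \<omega> assume "\<omega> \<in> space M"
    then show "norm (hinner H ((A \<omega> ^^ m) a) ((A \<omega> ^^ n) b))
        \<le> norm ((hnorm H ((A \<omega> ^^ m) a))\<^sup>2 + (hnorm H ((A \<omega> ^^ n) b))\<^sup>2)"
      using cmod_hinner_le_sum_squares[of "(A \<omega> ^^ m) a" "(A \<omega> ^^ n) b"] assms
      by (simp add: power_carrier)
  qed
qed

definition moment :: "nat \<Rightarrow> nat \<Rightarrow> 'h \<Rightarrow> 'h \<Rightarrow> complex" where
  "moment m n a b = (LINT \<omega>|M. hinner H ((A \<omega> ^^ m) a) ((A \<omega> ^^ n) b))"

lemma moment_scale_left:
  "a \<in> hcarrier H \<Longrightarrow> b \<in> hcarrier H \<Longrightarrow> moment m n (hscale H c a) b = cnj c * moment m n a b"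
  unfolding moment_def
  by (subst integral_mult_right_zero[symmetric], rule Bochner_Integration.integral_cong)
    (auto simp: power_scale hinner_scale_left power_carrier)

lemma moment_scale_right:
  "a \<in> hcarrier H \<Longrightarrow> b \<in> hcarrier H \<Longrightarrow> moment m n a (hscale H c b) = c * moment m n a b"
  unfolding moment_def
  by (subst integral_mult_right_zero[symmetric], rule Bochner_Integration.integral_cong)
    (auto simp: power_scale hinner_scale_right power_carrier)

lemma moment_add_left:
  assumes "a \<in> hcarrier H" "a' \<in> hcarrier H" "b \<in> hcarrier H"
  shows "moment m n (a + a') b = moment m n a b + moment m n a' b"
  unfolding moment_def
  by (subst Bochner_Integration.integral_add[symmetric],
      (intro integrable_moment assms)+, rule Bochner_Integration.integral_cong)
    (auto simp: assms power_add hinner_add_left power_carrier)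

lemma moment_add_right:
  assumes "a \<in> hcarrier H" "b \<in> hcarrier H" "b' \<in> hcarrier H"
  shows "moment m n a (b + b') = moment m n a b + moment m n a b'"
  unfolding moment_def
  by (subst Bochner_Integration.integral_add[symmetric],
      (intro integrable_moment assms)+, rule Bochner_Integration.integral_cong)
    (auto simp: assms power_add hinner_add_right power_carrier)

lemma moment_commute:
  assumes "a \<in> hcarrier H" "b \<in> hcarrier H"
  shows "moment m n a b = cnj (moment n m b a)"
proof -
  have "cnj (moment n m b a) = (LINT \<omega>|M. cnj (hinner H ((A \<omega> ^^ n) b) ((A \<omega> ^^ m) a)))"
    unfolding moment_def by (rule Bochner_Integration.integral_cnj[symmetric])
  also have "\<dots> = moment m n a b"
    unfolding moment_def
    by (intro Bochner_Integration.integral_cong refl hinner_commute[symmetric] power_carrier assms)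
  finally show ?thesis by simp
qed

lemma moment_zero_zero: "a \<in> hcarrier H \<Longrightarrow> b \<in> hcarrier H \<Longrightarrow> moment 0 0 a b = hinner H a b"
  using prob_space.prob_space[OF prob] by (simp add: moment_def)

text \<open>For a fixed operator \<open>A \<omega>\<close> the map \<open>a \<mapsto> (A \<omega>)\<^sup>n a\<close> is continuous, so by Fatou's lemma the second
  moments are lower semicontinuous in \<open>a\<close>; this is what the category argument needs.\<close>
lemma second_moment_bounded:
  "\<exists>C. \<forall>a\<in>hcarrier H. (LINT \<omega>|M. (hnorm H ((A \<omega> ^^ n) a))\<^sup>2) \<le> C * (hnorm H a)\<^sup>2"
proof (rule closed_sublevels_imp_bounded)
  let ?h = "\<lambda>a \<omega>. (hnorm H ((A \<omega> ^^ n) a))\<^sup>2"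
  show "(LINT \<omega>|M. ?h (a + b) \<omega>) \<le> 2 * (LINT \<omega>|M. ?h a \<omega>) + 2 * (LINT \<omega>|M. ?h b \<omega>)"
    if ab: "a \<in> hcarrier H" "b \<in> hcarrier H" for a b
  proof -
    have "(LINT \<omega>|M. ?h (a + b) \<omega>) \<le> (LINT \<omega>|M. 2 * ?h a \<omega> + 2 * ?h b \<omega>)"
    proof (rule integral_mono)
      fix \<omega> assume \<omega>: "\<omega> \<in> space M"
      let ?x = "hnorm H ((A \<omega> ^^ n) a)" and ?y = "hnorm H ((A \<omega> ^^ n) b)"
      have c: "(A \<omega> ^^ n) a \<in> hcarrier H" "(A \<omega> ^^ n) b \<in> hcarrier H" using ab \<omega> power_carrier by blast+
      have "?h (a + b) \<omega> \<le> (?x + ?y)\<^sup>2"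
        using hnorm_triangle[OF c] hnorm_nonneg[OF carrier_add[OF c]] ab \<omega>
        by (intro power_mono) (auto simp: power_add)
      also have "\<dots> \<le> 2 * ?x\<^sup>2 + 2 * ?y\<^sup>2"
        using sum_squares_bound[of ?x ?y] by (simp add: power2_sum)
      finally show "?h (a + b) \<omega> \<le> 2 * ?h a \<omega> + 2 * ?h b \<omega>" .
    qed (use ab carrier_add integrable_power2 in auto)
    also have "\<dots> = 2 * (LINT \<omega>|M. ?h a \<omega>) + 2 * (LINT \<omega>|M. ?h b \<omega>)"
      using ab integrable_power2 by simp
    finally show ?thesis .
  qed
  show "(LINT \<omega>|M. ?h (hscale H c a) \<omega>) = (cmod c)\<^sup>2 * (LINT \<omega>|M. ?h a \<omega>)"
    if "a \<in> hcarrier H" for c a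
    by (subst integral_mult_right_zero[symmetric], rule Bochner_Integration.integral_cong)
      (use that in \<open>auto simp: power_scale hnorm_scale power_carrier power_mult_distrib\<close>)
  show "(LINT \<omega>|M. ?h a \<omega>) \<le> B"
    if \<sigma>: "\<And>i. \<sigma> i \<in> hcarrier H" and a: "a \<in> hcarrier H"
      and lim: "(\<lambda>i. hnorm H (\<sigma> i - a)) \<longlonglongrightarrow> 0" and le: "\<And>i. (LINT \<omega>|M. ?h (\<sigma> i) \<omega>) \<le> B"
    for \<sigma> a B
  proof -
    have "0 \<le> (LINT \<omega>|M. ?h (\<sigma> 0) \<omega>)" by (intro Bochner_Integration.integral_nonneg) simp
    then have B: "0 \<le> B" using le[of 0] by linarith
    have nn: "(\<integral>\<^sup>+\<omega>. ennreal (?h b \<omega>) \<partial>M) = ennreal (LINT \<omega>|M. ?h b \<omega>)" if "b \<in> hcarrier H" for b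
      using integrable_power2[OF that] by (intro nn_integral_eq_integral) auto
    have conv: "(\<lambda>i. ?h (\<sigma> i) \<omega>) \<longlonglongrightarrow> ?h a \<omega>" if \<omega>: "\<omega> \<in> space M" for \<omega>
    proof -
      have l: "(\<lambda>i. hnorm H ((A \<omega> ^^ n) (\<sigma> i) - (A \<omega> ^^ n) a)) \<longlonglongrightarrow> 0"
        by (rule bounded_operator_tendsto[OF complex_inner_product_space_axioms operator_power[OF \<omega>] \<sigma> a lim])
      have "(\<lambda>i. hinner H ((A \<omega> ^^ n) (\<sigma> i)) ((A \<omega> ^^ n) (\<sigma> i))) \<longlonglongrightarrow> hinner H ((A \<omega> ^^ n) a) ((A \<omega> ^^ n) a)"
        using \<sigma> a \<omega> by (intro tendsto_hinner power_carrier l)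
      from tendsto_Re[OF this] show ?thesis
        using \<sigma> a \<omega> by (simp add: hnorm_power2 power_carrier)
    qed
    have "ennreal (LINT \<omega>|M. ?h a \<omega>) = (\<integral>\<^sup>+\<omega>. liminf (\<lambda>i. ennreal (?h (\<sigma> i) \<omega>)) \<partial>M)"
      unfolding nn[OF a, symmetric] using conv
      by (intro nn_integral_cong lim_imp_Liminf[symmetric] tendsto_ennrealI) auto
    also have "\<dots> \<le> liminf (\<lambda>i. \<integral>\<^sup>+\<omega>. ennreal (?h (\<sigma> i) \<omega>) \<partial>M)"
      using borel_measurable_integrable[OF integrable_power2[OF \<sigma>]] by (intro nn_integral_liminf) simp
    also have "\<dots> \<le> liminf (\<lambda>i::nat. ennreal B)"
      using le by (intro Liminf_mono always_eventually) (simp add: nn \<sigma> ennreal_leI)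
    also have "\<dots> = ennreal B" by (simp add: Liminf_const)
    finally show ?thesis using B by simp
  qed
qed

lemma moment_bounded:
  assumes b: "b \<in> hcarrier H"
  shows "\<exists>B. \<forall>a\<in>hcarrier H. cmod (moment m n a b) \<le> B * hnorm H a"
proof -
  obtain C where C: "\<And>a. a \<in> hcarrier H \<Longrightarrow> (LINT \<omega>|M. (hnorm H ((A \<omega> ^^ m) a))\<^sup>2) \<le> C * (hnorm H a)\<^sup>2"
    using second_moment_bounded by blast
  define D where "D = (LINT \<omega>|M. (hnorm H ((A \<omega> ^^ n) b))\<^sup>2)"
  \<comment> \<open>on the unit sphere both second moments are bounded; homogeneity in a does the rest\<close>
  have unit: "cmod (moment m n a b) \<le> C + D" if a: "a \<in> hcarrier H" "hnorm H a = 1" for a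
  proof -
    have "cmod (moment m n a b) \<le> (LINT \<omega>|M. cmod (hinner H ((A \<omega> ^^ m) a) ((A \<omega> ^^ n) b)))"
      unfolding moment_def by (rule integral_norm_bound)
    also have "\<dots> \<le> (LINT \<omega>|M. (hnorm H ((A \<omega> ^^ m) a))\<^sup>2 + (hnorm H ((A \<omega> ^^ n) b))\<^sup>2)"
    proof (rule integral_mono)
      fix \<omega> assume \<omega>: "\<omega> \<in> space M"
      show "cmod (hinner H ((A \<omega> ^^ m) a) ((A \<omega> ^^ n) b))
          \<le> (hnorm H ((A \<omega> ^^ m) a))\<^sup>2 + (hnorm H ((A \<omega> ^^ n) b))\<^sup>2"
        using a b \<omega> by (intro cmod_hinner_le_sum_squares power_carrier)
    qed (use a b integrable_moment integrable_power2 in auto)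
    also have "\<dots> = (LINT \<omega>|M. (hnorm H ((A \<omega> ^^ m) a))\<^sup>2) + D"
      unfolding D_def using a b integrable_power2 by simp
    also have "\<dots> \<le> C + D" using C[OF a(1)] a(2) by simp
    finally show ?thesis .
  qed
  have "cmod (moment m n a b) \<le> (C + D) * hnorm H a" if a: "a \<in> hcarrier H" for a
  proof (cases "hnorm H a = 0")
    case True
    then have "a = hscale H 0 a" using hnorm_eq_zero a by simp
    then have "moment m n a b = 0" using moment_scale_left[OF a b, of m n 0] by simp
    then show ?thesis using True by simp
  next
    case False
    then have pos: "hnorm H a > 0" using hnorm_nonneg[OF a] by simp
    let ?u = "hscale H (of_real (1 / hnorm H a)) a"
    have "hnorm H ?u = 1" unfolding hnorm_scale[OF a] norm_of_real using pos by simp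
    then have "cmod (moment m n ?u b) \<le> C + D" using unit carrier_scale[OF a] by blast
    then have "cmod (moment m n a b) / hnorm H a \<le> C + D"
      unfolding moment_scale_left[OF a b] norm_mult complex_mod_cnj norm_of_real using pos by simp
    then show ?thesis using pos by (simp add: pos_divide_le_eq)
  qed
  then show ?thesis by blast
qed

text \<open>The moments are bounded in \<open>a\<close>, so the vector that the definition of \<open>moment_kernel\<close> describes
  exists by the Riesz theorem.\<close>
lemma moment_kernel_inner:
  assumes b: "b \<in> hcarrier H"
  shows "moment_kernel M H A m n b \<in> hcarrier H"
    and "a \<in> hcarrier H \<Longrightarrow> hinner H a (moment_kernel M H A m n b) = moment m n a b"
proof -
  obtain B where B: "\<And>a. a \<in> hcarrier H \<Longrightarrow> cmod (moment m n a b) \<le> B * hnorm H a"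
    using moment_bounded[OF b] by blast
  have "\<exists>v\<in>hcarrier H. \<forall>x\<in>hcarrier H. hinner H v x = cnj (moment m n x b)"
    using B b by (intro riesz_representation[of _ B]) (auto simp: moment_add_left moment_scale_left)
  then obtain v where v: "v \<in> hcarrier H" "\<And>x. x \<in> hcarrier H \<Longrightarrow> hinner H v x = cnj (moment m n x b)"
    by blast
  have v': "hinner H x v = moment m n x b" if "x \<in> hcarrier H" for x
    using v(2)[OF that] hinner_commute[OF that v(1)] by simp
  have "moment_kernel M H A m n b = v"
    unfolding moment_kernel_def moment_def[symmetric] by (rule the_representative[OF v(1) v'])
  then show "moment_kernel M H A m n b \<in> hcarrier H"
    and "a \<in> hcarrier H \<Longrightarrow> hinner H a (moment_kernel M H A m n b) = moment m n a b"
    using v v' by auto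
qed

end

section \<open>A constrained dilation forces the kernel inequality\<close>

lemma dilation_inner:
  assumes H: "complex_hilbert_space H" and K: "complex_hilbert_space K"
    and U: "bounded_operator K K U" and P: "bounded_operator K K P" and W: "bounded_operator H K W"
    and a: "a \<in> hcarrier H"
  shows "hadjoint H K W ((hadjoint K K U ^^ m) (P ((U ^^ n) (W a)))) \<in> hcarrier H"
    and "z \<in> hcarrier H \<Longrightarrow>
      hinner H z (hadjoint H K W ((hadjoint K K U ^^ m) (P ((U ^^ n) (W a)))))
      = hinner K ((U ^^ m) (W z)) (P ((U ^^ n) (W a)))"
proof -
  interpret K: complex_hilbert_space K by fact
  have Un: "bounded_operator K K (U ^^ n)"
    by (rule bounded_operator_funpow[OF K.complex_inner_product_space_axioms U])
  have p: "P ((U ^^ n) (W a)) \<in> hcarrier K"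
    by (intro bounded_operatorD(1)[OF P] bounded_operatorD(1)[OF Un] bounded_operatorD(1)[OF W] a)
  note pow = hadjoint_power_inner[OF K U p]
  note adj = hadjoint_exists[OF H K.complex_inner_product_space_axioms W pow(1)]
  show "hadjoint H K W ((hadjoint K K U ^^ m) (P ((U ^^ n) (W a)))) \<in> hcarrier H" by (rule adj(1))
  show "z \<in> hcarrier H \<Longrightarrow>
      hinner H z (hadjoint H K W ((hadjoint K K U ^^ m) (P ((U ^^ n) (W a)))))
      = hinner K ((U ^^ m) (W z)) (P ((U ^^ n) (W a)))"
    using adj(2) pow(2) bounded_operatorD(1)[OF W] by simp
qed

text \<open>Testing the operator inequality on the vector \<open>\<Sum>\<^sub>i U\<^sup>m\<^sup>i W a\<^sub>i\<close> gives exactly the inequality of kernels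
  for the family of pairs \<open>(m\<^sub>i, a\<^sub>i)\<close>.\<close>
lemma dilation_imp_kernel_le:
  assumes H: "complex_hilbert_space H"
    and dil: "moment_dilation M H A K U P W"
    and le: "operator_le_on K (orbit_span H K U W) (\<lambda>y. hadjoint K K U (P (U y))) P"
  shows "kernel_le H (shift_kernel (moment_kernel M H A)) (moment_kernel M H A)"
  unfolding kernel_le_def positive_definite_kernel_def
proof (intro allI impI)
  fix N :: nat and m :: "nat \<Rightarrow> nat" and a :: "nat \<Rightarrow> 'a"
  assume a: "\<forall>i<N. a i \<in> hcarrier H"
  have K: "complex_hilbert_space K" and U: "bounded_operator K K U" and P: "bounded_operator K K P"
    and W: "bounded_operator H K W"
    and mom: "\<And>m n a. a \<in> hcarrier H \<Longrightarrow> moment_kernel M H A m n a =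
        hadjoint H K W ((hadjoint K K U ^^ m) (P ((U ^^ n) (W a))))"
    using dil by (auto simp: moment_dilation_def unitary_operator_def selfadjoint_projection_def
        isometry_operator_def)
  interpret H: complex_hilbert_space H by fact
  interpret K: complex_hilbert_space K by fact
  note Kip = K.complex_inner_product_space_axioms
  define v where "v i = (U ^^ m i) (W (a i))" for i
  define y where "y = (\<Sum>i<N. v i)"
  have orbit: "(U ^^ k) (W b) \<in> hcarrier K" if "b \<in> hcarrier H" for k b
    using bounded_operatorD(1)[OF bounded_operator_funpow[OF Kip U] bounded_operatorD(1)[OF W that]] .
  have v: "v i \<in> hcarrier K" if "i \<in> {..<N}" for i using orbit a that by (simp add: v_def)
  have y: "y \<in> hcarrier K" unfolding y_def using v by (rule K.carrier_sum)
  note Pv = bounded_operatorD(1)[OF P] and Uv = bounded_operatorD(1)[OF U]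
  have "y \<in> orbit_span H K U W"
  proof -
    let ?S = "{(U ^^ k) (W a) | k a. a \<in> hcarrier H}"
    interpret Metric_space "hcarrier K" "hdist K" by (rule K.Metric_space_hdist)
    have "K.span ?S \<subseteq> hcarrier K" using orbit by (intro K.span_minimal K.subspace_carrier) blast
    then have "K.span ?S \<subseteq> htopology K closure_of K.span ?S"
      by (intro closure_of_subset) (simp add: htopology_def)
    moreover have "y \<in> K.span ?S"
      unfolding y_def v_def using a by (intro K.span_sum K.span_base) blast
    ultimately show ?thesis by (auto simp: orbit_span_def)
  qed
  then have "hinner K y (hadjoint K K U (P (U y))) \<le> hinner K y (P y)"
    using le by (simp add: operator_le_on_def)
  then have ineq: "hinner K (U y) (P (U y)) \<le> hinner K y (P y)"
    using hadjoint_exists(2)[OF K Kip U Pv[OF Uv[OF y]] y] by simp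
  have expand: "hinner K (\<Sum>i<N. w i) (P (\<Sum>i<N. w i)) = (\<Sum>i<N. \<Sum>j<N. hinner K (w i) (P (w j)))"
    if w: "\<And>i. i \<in> {..<N} \<Longrightarrow> w i \<in> hcarrier K" for w
  proof -
    have "P (\<Sum>i<N. w i) = (\<Sum>i<N. P (w i))"
      using w by (rule bounded_operator_sum[OF Kip Kip P])
    then have "hinner K (\<Sum>i<N. w i) (P (\<Sum>i<N. w i)) = hinner K (\<Sum>i<N. w i) (\<Sum>i<N. P (w i))"
      by (rule arg_cong)
    also have "\<dots> = (\<Sum>i<N. \<Sum>j<N. hinner K (w i) (P (w j)))"
      by (intro K.hinner_sum_sum w Pv)
    finally show ?thesis .
  qed
  have terms: "hinner H (a i) (moment_kernel M H A (m i) (m j) (a j) -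
        shift_kernel (moment_kernel M H A) (m i) (m j) (a j))
      = hinner K (v i) (P (v j)) - hinner K (U (v i)) (P (U (v j)))"
    if "i < N" "j < N" for i j
  proof -
    have ai: "a i \<in> hcarrier H" and aj: "a j \<in> hcarrier H" using a that by blast+
    note d = dilation_inner[OF H K U P W aj]
    show ?thesis
      unfolding shift_kernel_def mom[OF aj] H.hinner_diff_right[OF ai d(1) d(1)] d(2)[OF ai]
      by (simp add: v_def)
  qed
  have "(\<Sum>i<N. \<Sum>j<N. hinner H (a i) (moment_kernel M H A (m i) (m j) (a j) -
        shift_kernel (moment_kernel M H A) (m i) (m j) (a j)))
      = (\<Sum>i<N. \<Sum>j<N. hinner K (v i) (P (v j)) - hinner K (U (v i)) (P (U (v j))))"
    using terms by (intro sum.cong) auto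
  also have "\<dots> = hinner K y (P y) - hinner K (U y) (P (U y))"
  proof -
    have "U y = (\<Sum>i<N. U (v i))"
      unfolding y_def using v by (rule bounded_operator_sum[OF Kip Kip U])
    moreover have "hinner K y (P y) = (\<Sum>i<N. \<Sum>j<N. hinner K (v i) (P (v j)))"
      unfolding y_def using v by (rule expand)
    moreover have "hinner K (\<Sum>i<N. U (v i)) (P (\<Sum>i<N. U (v i))) =
        (\<Sum>i<N. \<Sum>j<N. hinner K (U (v i)) (P (U (v j))))"
      using Uv[OF v] by (rule expand)
    ultimately show ?thesis by (simp add: sum_subtractf)
  qed
  finally show "0 \<le> (\<Sum>i<N. \<Sum>j<N. hinner H (a i) (moment_kernel M H A (m i) (m j) (a j) -
        shift_kernel (moment_kernel M H A) (m i) (m j) (a j)))"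
    using ineq by (simp add: less_eq_complex_def)
qed

section \<open>Positivity of the dilation kernel\<close>

context random_operator_with_moments
begin

lemma moment_positive:
  assumes F: "finite F" and v: "\<And>x. x \<in> F \<Longrightarrow> v x \<in> hcarrier H"
  shows "0 \<le> Re (\<Sum>x\<in>F. \<Sum>y\<in>F. moment (m x) (m y) (v x) (v y))"
proof -
  let ?s = "\<lambda>\<omega>. \<Sum>x\<in>F. (A \<omega> ^^ m x) (v x)"
  have "(\<Sum>x\<in>F. \<Sum>y\<in>F. moment (m x) (m y) (v x) (v y))
      = (LINT \<omega>|M. (\<Sum>x\<in>F. \<Sum>y\<in>F. hinner H ((A \<omega> ^^ m x) (v x)) ((A \<omega> ^^ m y) (v y))))"
    unfolding moment_def using v
    by (simp add: Bochner_Integration.integral_sum Bochner_Integration.integrable_sum integrable_moment)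
  also have "\<dots> = (LINT \<omega>|M. of_real ((hnorm H (?s \<omega>))\<^sup>2))"
  proof (rule Bochner_Integration.integral_cong)
    fix \<omega> assume \<omega>: "\<omega> \<in> space M"
    have c: "(A \<omega> ^^ m x) (v x) \<in> hcarrier H" if "x \<in> F" for x using power_carrier[OF \<omega>] v that by blast
    have s: "?s \<omega> \<in> hcarrier H" using c by (rule carrier_sum)
    show "(\<Sum>x\<in>F. \<Sum>y\<in>F. hinner H ((A \<omega> ^^ m x) (v x)) ((A \<omega> ^^ m y) (v y))) = of_real ((hnorm H (?s \<omega>))\<^sup>2)"
      unfolding hinner_self[OF s, symmetric] using c by (intro hinner_sum_sum[symmetric])
  qed simp
  also have "\<dots> = of_real (LINT \<omega>|M. (hnorm H (?s \<omega>))\<^sup>2)" by (rule integral_complex_of_real)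
  finally show ?thesis by (simp del: of_real_power)
qed

definition clip :: "'h \<Rightarrow> 'h" where
  "clip a = (if a \<in> hcarrier H then a else 0)"

lemma clip_carrier: "clip a \<in> hcarrier H"
  using carrier_zero by (simp add: clip_def)

lemma clip_id: "a \<in> hcarrier H \<Longrightarrow> clip a = a"
  by (simp add: clip_def)

text \<open>The value at \<open>(p, m, a)\<close> and \<open>(q, n, b)\<close> has to be \<open>\<langle>U\<^sup>p T\<^sup>m W a, U\<^sup>q T\<^sup>n W b\<rangle>\<close>.  Moving the smaller
  of \<open>p\<close> and \<open>q\<close> to the other side leaves a nonnegative power of \<open>U\<close> there, which acts between vectors
  of the space of \<open>T\<close> as the same power of \<open>T\<close>; the truncation in \<open>nat\<close> selects the side.  A triple
  whose last component lies off the carrier stands for the zero vector.\<close>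
definition dilation_kernel :: "int \<times> nat \<times> 'h \<Rightarrow> int \<times> nat \<times> 'h \<Rightarrow> complex" where
  "dilation_kernel = (\<lambda>(p, m, a) (q, n, b).
     moment (m + nat (p - q)) (n + nat (q - p)) (clip a) (clip b))"

lemma dilation_kernel_eq:
  "dilation_kernel (p, m, a) (q, n, b) =
     moment (m + nat (p - q)) (n + nat (q - p)) (clip a) (clip b)"
  by (simp add: dilation_kernel_def)

end

locale shift_contractive = random_operator_with_moments +
  assumes shift_le: "kernel_le H (shift_kernel (moment_kernel M H A)) (moment_kernel M H A)"
begin

lemma moment_shift_le:
  assumes F: "finite F" and v: "\<And>x. x \<in> F \<Longrightarrow> v x \<in> hcarrier H"
  shows "Re (\<Sum>x\<in>F. \<Sum>y\<in>F. moment (Suc (m x)) (Suc (m y)) (v x) (v y))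
    \<le> Re (\<Sum>x\<in>F. \<Sum>y\<in>F. moment (m x) (m y) (v x) (v y))"
proof -
  obtain h where h: "bij_betw h {..<card F} F"
    using ex_bij_betw_nat_finite[OF F] by (auto simp: lessThan_atLeast0)
  have vh: "v (h i) \<in> hcarrier H" if "i < card F" for i
    using v bij_betwE[OF h] that by blast
  let ?d = "\<lambda>x y. moment (m x) (m y) (v x) (v y) - moment (Suc (m x)) (Suc (m y)) (v x) (v y)"
  have "0 \<le> (\<Sum>i<card F. \<Sum>j<card F. hinner H (v (h i))
      (moment_kernel M H A (m (h i)) (m (h j)) (v (h j))
        - shift_kernel (moment_kernel M H A) (m (h i)) (m (h j)) (v (h j))))"
    using shift_le[unfolded kernel_le_def positive_definite_kernel_def, rule_format,
        of "card F" "\<lambda>i. v (h i)" "\<lambda>i. m (h i)"] vh by blast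
  also have "\<dots> = (\<Sum>i<card F. \<Sum>j<card F. ?d (h i) (h j))"
  proof (intro sum.cong refl)
    fix i j assume "i \<in> {..<card F}" "j \<in> {..<card F}"
    then have c: "v (h i) \<in> hcarrier H" "v (h j) \<in> hcarrier H" using vh by auto
    show "hinner H (v (h i)) (moment_kernel M H A (m (h i)) (m (h j)) (v (h j))
        - shift_kernel (moment_kernel M H A) (m (h i)) (m (h j)) (v (h j))) = ?d (h i) (h j)"
      using moment_kernel_inner(2)[OF c(2,1)]
        hinner_diff_right[OF c(1) moment_kernel_inner(1)[OF c(2)] moment_kernel_inner(1)[OF c(2)]]
      by (simp add: shift_kernel_def)
  qed
  also have "\<dots> = (\<Sum>x\<in>F. \<Sum>y\<in>F. ?d x y)"
    by (simp add: sum.reindex_bij_betw[OF h, of "\<lambda>y. ?d _ y"]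
        sum.reindex_bij_betw[OF h, of "\<lambda>x. \<Sum>y\<in>F. ?d x y"])
  finally show ?thesis
    by (simp add: less_eq_complex_def sum_subtractf)
qed

lemma moment_add_le:
  assumes F: "finite F" and v: "\<And>x. x \<in> F \<Longrightarrow> v x \<in> hcarrier H"
  shows "Re (\<Sum>x\<in>F. \<Sum>y\<in>F. moment (m x + k) (m y + k) (v x) (v y))
    \<le> Re (\<Sum>x\<in>F. \<Sum>y\<in>F. moment (m x) (m y) (v x) (v y))"
proof (induction k)
  case (Suc k)
  have "Re (\<Sum>x\<in>F. \<Sum>y\<in>F. moment (Suc (m x + k)) (Suc (m y + k)) (v x) (v y))
      \<le> Re (\<Sum>x\<in>F. \<Sum>y\<in>F. moment (m x + k) (m y + k) (v x) (v y))"
    by (rule moment_shift_le[OF F]) (rule v)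
  then show ?case using Suc by simp
qed simp

text \<open>Write \<open>S r\<close> for the squared norm of the vector that results when every member of the family is
  moved down from its level to the level \<open>r\<close> by the contraction.  Adding the members in the order of
  decreasing level, the cross terms of the new member with the old ones are the same in the dilation
  kernel and in \<open>S p\<close>, where \<open>p\<close> is the level of the new member; moving from \<open>p\<close> further down to \<open>r\<close>
  only decreases the norm.\<close>
lemma moments_le_dilation_sum:
  fixes lev :: "'i \<Rightarrow> int"
  assumes F: "finite F" and v: "\<And>x. v x \<in> hcarrier H"
    and r: "\<And>x. x \<in> F \<Longrightarrow> r \<le> lev x"
  shows "Re (\<Sum>x\<in>F. \<Sum>y\<in>F. moment (m x + nat (lev x - r)) (m y + nat (lev y - r)) (v x) (v y))
    \<le> Re (\<Sum>x\<in>F. \<Sum>y\<in>F. moment (m x + nat (lev x - lev y)) (m y + nat (lev y - lev x)) (v x) (v y))"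
proof -
  define S where "S r x y = moment (m x + nat (lev x - r)) (m y + nat (lev y - r)) (v x) (v y)" for r x y
  define D where "D x y = moment (m x + nat (lev x - lev y)) (m y + nat (lev y - lev x)) (v x) (v y)" for x y
  have "\<forall>r. (\<forall>x\<in>F. r \<le> lev x) \<longrightarrow> Re (\<Sum>x\<in>F. \<Sum>y\<in>F. S r x y) \<le> Re (\<Sum>x\<in>F. \<Sum>y\<in>F. D x y)"
    using F
  proof (induction F rule: finite_ranking_induct[where f="\<lambda>x. - lev x"])
    case (insert x F)
    show ?case
    proof (cases "x \<in> F")
      case True
      then show ?thesis using insert.IH by (simp add: insert_absorb)
    next
      case False
      have lev: "lev x \<le> lev y" if "y \<in> insert x F" for y using insert.hyps(2) that by auto
      have split: "(\<Sum>y\<in>insert x F. \<Sum>z\<in>insert x F. G y z) =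
          G x x + (\<Sum>z\<in>F. G x z) + (\<Sum>y\<in>F. G y x) + (\<Sum>y\<in>F. \<Sum>z\<in>F. G y z)" for G :: "'i \<Rightarrow> 'i \<Rightarrow> complex"
        using False insert.hyps(1) by (simp add: sum.distrib algebra_simps)
      have "D x x = S (lev x) x x" "\<And>y. y \<in> F \<Longrightarrow> D x y = S (lev x) x y"
        "\<And>y. y \<in> F \<Longrightarrow> D y x = S (lev x) y x"
        using lev by (auto simp: D_def S_def)
      then have cross: "Re (\<Sum>y\<in>insert x F. \<Sum>z\<in>insert x F. S (lev x) y z)
          \<le> Re (\<Sum>y\<in>insert x F. \<Sum>z\<in>insert x F. D y z)"
        unfolding split using insert.IH lev by simp
      show ?thesis
      proof (intro allI impI)
        fix r assume r: "\<forall>y\<in>insert x F. r \<le> lev y"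
        define k where "k = nat (lev x - r)"
        have "nat (lev y - r) = nat (lev y - lev x) + k" if "y \<in> insert x F" for y
          using lev[OF that] r by (simp add: k_def nat_add_distrib[symmetric])
        then have "(\<Sum>y\<in>insert x F. \<Sum>z\<in>insert x F. S r y z) =
            (\<Sum>y\<in>insert x F. \<Sum>z\<in>insert x F. moment (m y + nat (lev y - lev x) + k) (m z + nat (lev z - lev x) + k) (v y) (v z))"
          unfolding S_def by (intro sum.cong) (auto simp: add.assoc)
        moreover have "Re (\<Sum>y\<in>insert x F. \<Sum>z\<in>insert x F. moment (m y + nat (lev y - lev x) + k) (m z + nat (lev z - lev x) + k) (v y) (v z))
            \<le> Re (\<Sum>y\<in>insert x F. \<Sum>z\<in>insert x F. S (lev x) y z)"
          unfolding S_def using insert.hyps(1) v by (intro moment_add_le) auto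
        ultimately show "Re (\<Sum>y\<in>insert x F. \<Sum>z\<in>insert x F. S r y z)
            \<le> Re (\<Sum>y\<in>insert x F. \<Sum>z\<in>insert x F. D y z)"
          using cross by simp
      qed
    qed
  qed simp
  then show ?thesis using r unfolding S_def D_def by blast
qed

lemma psd_dilation_kernel: "psd_kernel dilation_kernel"
proof
  show "dilation_kernel x y = cnj (dilation_kernel y x)" for x y
    by (cases x; cases y) (auto simp: dilation_kernel_eq clip_carrier moment_commute[symmetric])
  fix F :: "(int \<times> nat \<times> 'a) set" and c :: "int \<times> nat \<times> 'a \<Rightarrow> complex"
  assume F: "finite F"
  define lev :: "int \<times> nat \<times> 'a \<Rightarrow> int" where "lev x = fst x" for x
  define m :: "int \<times> nat \<times> 'a \<Rightarrow> nat" where "m x = fst (snd x)" for x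
  define v where "v x = hscale H (c x) (clip (snd (snd x)))" for x
  have v: "v x \<in> hcarrier H" for x by (simp add: v_def carrier_scale clip_carrier)
  have terms: "cnj (c x) * c y * dilation_kernel x y =
      moment (m x + nat (lev x - lev y)) (m y + nat (lev y - lev x)) (v x) (v y)" for x y
    by (cases x; cases y) (simp add: dilation_kernel_eq v_def m_def lev_def moment_scale_left
        moment_scale_right clip_carrier carrier_scale)
  obtain r where r: "\<And>x. x \<in> F \<Longrightarrow> r \<le> lev x"
    using F by (meson Min_le finite_imageI imageI)
  have "0 \<le> Re (\<Sum>x\<in>F. \<Sum>y\<in>F. moment (m x + nat (lev x - r)) (m y + nat (lev y - r)) (v x) (v y))"
    by (rule moment_positive[OF F v])
  also have "\<dots> \<le> Re (\<Sum>x\<in>F. \<Sum>y\<in>F. cnj (c x) * c y * dilation_kernel x y)"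
    unfolding terms by (rule moments_le_dilation_sum[OF F v r])
  finally show "0 \<le> Re (\<Sum>x\<in>F. \<Sum>y\<in>F. cnj (c x) * c y * dilation_kernel x y)" .
qed

end

section \<open>The dilation on the space of the dilation kernel\<close>

context shift_contractive
begin

sublocale psd: psd_kernel dilation_kernel
  by (rule psd_dilation_kernel)

sublocale K: complex_hilbert_space psd.rkhs
  by (rule psd.rkhs_hilbert)

abbreviation "\<K> \<equiv> psd.rkhs"

abbreviation vec :: "int \<Rightarrow> nat \<Rightarrow> 'a \<Rightarrow> 'a dilation_vec" where
  "vec p n a \<equiv> psd.point (p, n, a)"

definition shift_by :: "int \<Rightarrow> 'a dilation_vec \<Rightarrow> 'a dilation_vec" where
  "shift_by d f = f \<circ> (\<lambda>(p, n, a). (p - d, n, a))"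

lemma carrier_eq: "hcarrier \<K> = psd.space" and scale_eq: "hscale \<K> = scale_fun"
  by (auto simp: psd.rkhs_simps)

lemma vec_carrier: "vec p n a \<in> hcarrier \<K>"
  by (simp add: carrier_eq psd.point_in_space)

lemma inner_vec: "f \<in> hcarrier \<K> \<Longrightarrow> hinner \<K> (vec p n a) f = f (p, n, a)"
  by (simp add: carrier_eq psd.reproducing)

lemma shift_by_carrier: "f \<in> hcarrier \<K> \<Longrightarrow> shift_by d f \<in> hcarrier \<K>"
  and shift_by_inner: "f \<in> hcarrier \<K> \<Longrightarrow> g \<in> hcarrier \<K> \<Longrightarrow>
    hinner \<K> (shift_by d f) (shift_by d g) = hinner \<K> f g"
proof -
  let ?\<tau> = "\<lambda>(p :: int, n :: nat, a :: 'a). (p - d, n, a)"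
  have bij: "bij ?\<tau>"
    by (rule bij_betw_byWitness[where f'="\<lambda>(p, n, a). (p + d, n, a)"]) auto
  have inv: "dilation_kernel (?\<tau> x) (?\<tau> y) = dilation_kernel x y" for x y
    by (cases x; cases y) (simp add: dilation_kernel_eq)
  show "f \<in> hcarrier \<K> \<Longrightarrow> shift_by d f \<in> hcarrier \<K>"
    and "f \<in> hcarrier \<K> \<Longrightarrow> g \<in> hcarrier \<K> \<Longrightarrow>
      hinner \<K> (shift_by d f) (shift_by d g) = hinner \<K> f g"
    unfolding shift_by_def carrier_eq using psd.composition_isometry[OF bij inv] by blast+
qed

lemma shift_by_shift_by: "shift_by d (shift_by e f) = shift_by (d + e) f"
  by (auto simp: shift_by_def fun_eq_iff algebra_simps)

lemma shift_by_zero: "shift_by 0 f = f"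
  by (auto simp: shift_by_def fun_eq_iff)

lemma shift_by_vec: "shift_by d (vec p n a) = vec (p + d) n a"
  by (auto simp: shift_by_def fun_eq_iff dilation_kernel_eq algebra_simps)

lemma shift_by_adjoint:
  assumes "f \<in> hcarrier \<K>"
  shows "hadjoint \<K> \<K> (shift_by d) f = shift_by (- d) f"
  unfolding hadjoint_def
proof (rule K.the_representative)
  show "shift_by (- d) f \<in> hcarrier \<K>" using assms by (rule shift_by_carrier)
  fix g assume "g \<in> hcarrier \<K>"
  then show "hinner \<K> g (shift_by (- d) f) = hinner \<K> (shift_by d g) f"
    using shift_by_inner[of g "shift_by (- d) f" d] shift_by_carrier[OF assms]
    by (simp add: shift_by_shift_by shift_by_zero)
qed

lemma shift_by_bounded: "bounded_operator \<K> \<K> (shift_by d)"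
  unfolding bounded_operator_def
proof (intro conjI ballI allI)
  show "\<exists>B. \<forall>f\<in>hcarrier \<K>. hnorm \<K> (shift_by d f) \<le> B * hnorm \<K> f"
    by (intro exI[of _ 1]) (simp add: hnorm_def shift_by_inner)
  show "shift_by d \<in> hcarrier \<K> \<rightarrow> hcarrier \<K>" using shift_by_carrier by blast
qed (auto simp: shift_by_def scale_eq scale_fun_def fun_eq_iff)

lemma shift_by_unitary: "unitary_operator \<K> (shift_by d)"
  unfolding unitary_operator_def
  using shift_by_bounded shift_by_carrier by (simp add: shift_by_adjoint shift_by_shift_by shift_by_zero)

lemma shift_by_power: "(shift_by 1 ^^ n) f = shift_by (int n) f"
  by (induction n) (auto simp: shift_by_zero shift_by_shift_by)

text \<open>By the reproducing property the functions that vanish at level \<open>0\<close> are those orthogonal to all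
  vectors of level \<open>0\<close>.  The vectors at \<open>(p, n, a)\<close> and \<open>(0, n + p, a)\<close> have the same values at level \<open>0\<close>,
  so removing the component that vanishes there takes the first to the second, which is the
  relation \<open>P U\<^sup>p = T\<^sup>p\<close>.\<close>
lemma level_projection_exists:
  "\<exists>P. selfadjoint_projection \<K> P \<and> (\<forall>p\<ge>0. \<forall>n a. P (vec p n a) = vec 0 (n + nat p) a)"
proof -
  define Z where "Z = {f \<in> hcarrier \<K>. \<forall>n a. f (0, n, a) = 0}"
  have "K.subspace Z"
    unfolding Z_def using K.carrier_zero K.carrier_add K.carrier_scale
    by (intro K.subspaceI) (auto simp: scale_eq scale_fun_def)
  moreover have "Z \<subseteq> hcarrier \<K>" by (auto simp: Z_def)
  moreover have "f \<in> Z" if \<sigma>: "\<And>i. \<sigma> i \<in> Z" and f: "f \<in> hcarrier \<K>"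
    and lim: "(\<lambda>i. hnorm \<K> (\<sigma> i - f)) \<longlonglongrightarrow> 0" for \<sigma> f
  proof -
    have "f (0, n, a) = 0" for n a
    proof -
      have \<sigma>K: "\<sigma> i \<in> hcarrier \<K>" and \<sigma>0: "\<sigma> i (0, n, a) = 0" for i using \<sigma>[of i] by (auto simp: Z_def)
      have "(\<lambda>i. hinner \<K> (vec 0 n a) (\<sigma> i)) \<longlonglongrightarrow> hinner \<K> (vec 0 n a) f"
        using K.hinner_zero_right[OF K.carrier_zero]
        by (intro K.tendsto_hinner vec_carrier \<sigma>K f lim) (simp add: hnorm_def)
      then have "(\<lambda>i::nat. 0) \<longlonglongrightarrow> f (0, n, a)"
        by (simp only: inner_vec[OF \<sigma>K] inner_vec[OF f] \<sigma>0)
      then show ?thesis by (simp add: LIMSEQ_const_iff)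
    qed
    then show ?thesis using f by (simp add: Z_def)
  qed
  ultimately have "\<exists>P. selfadjoint_projection \<K> P \<and>
      (\<forall>u\<in>hcarrier \<K>. \<forall>v\<in>hcarrier \<K>.
        u - v \<in> Z \<longrightarrow> (\<forall>z\<in>Z. hinner \<K> z v = 0) \<longrightarrow> P u = v)"
    by (rule K.orthogonal_projection_exists)
  then obtain P where P: "selfadjoint_projection \<K> P"
    and char: "\<And>u v. \<lbrakk>u \<in> hcarrier \<K>; v \<in> hcarrier \<K>; u - v \<in> Z; \<And>z. z \<in> Z \<Longrightarrow> hinner \<K> z v = 0\<rbrakk>
      \<Longrightarrow> P u = v"
    by blast
  have "P (vec p n a) = vec 0 (n + nat p) a" if p: "p \<ge> 0" for p n a
  proof (rule char[OF vec_carrier vec_carrier])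
    have "vec p n a - vec 0 (n + nat p) a \<in> hcarrier \<K>"
      using K.carrier_diff[OF vec_carrier vec_carrier] .
    then show "vec p n a - vec 0 (n + nat p) a \<in> Z"
      using p by (simp add: Z_def dilation_kernel_eq)
    fix z assume "z \<in> Z"
    then have "z \<in> hcarrier \<K>" "z (0, n + nat p, a) = 0" by (auto simp: Z_def)
    then show "hinner \<K> z (vec 0 (n + nat p) a) = 0"
      using K.hinner_commute[OF _ vec_carrier] by (simp add: inner_vec)
  qed
  with P show ?thesis by blast
qed

lemma vec_add: "a \<in> hcarrier H \<Longrightarrow> b \<in> hcarrier H \<Longrightarrow> vec p n (a + b) = vec p n a + vec p n b"
  by (auto simp: fun_eq_iff dilation_kernel_eq clip_id carrier_add moment_add_right clip_carrier)

lemma vec_scale: "a \<in> hcarrier H \<Longrightarrow> vec p n (hscale H c a) = hscale \<K> c (vec p n a)"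
  by (auto simp: fun_eq_iff dilation_kernel_eq clip_id carrier_scale moment_scale_right clip_carrier
      scale_eq scale_fun_def)

lemma inner_vec_level_zero:
  "a \<in> hcarrier H \<Longrightarrow> b \<in> hcarrier H \<Longrightarrow> hinner \<K> (vec 0 m a) (vec 0 n b) = moment m n a b"
  by (simp add: inner_vec vec_carrier dilation_kernel_eq clip_id)

lemma embedding_isometry: "isometry_operator H \<K> (vec 0 0)"
proof -
  have norm: "hnorm \<K> (vec 0 0 a) = hnorm H a" if "a \<in> hcarrier H" for a
    using that by (simp add: hnorm_def inner_vec_level_zero moment_zero_zero)
  then show ?thesis
    unfolding isometry_operator_def bounded_operator_def
    by (auto simp: vec_carrier vec_add vec_scale intro: exI[of _ 1])
qed

lemma power_vec: "(shift_by 1 ^^ n) (vec 0 0 a) = vec (int n) 0 a"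
  by (simp add: shift_by_power shift_by_vec)

theorem constrained_dilation_exists:
  "\<exists>(K :: 'a dilation_vec hilbert) U P W. moment_dilation M H A K U P W \<and>
     operator_le_on K (orbit_span H K U W) (\<lambda>y. hadjoint K K U (P (U y))) P"
proof -
  obtain P where P: "selfadjoint_projection \<K> P"
    and P_vec: "\<And>p n a. p \<ge> 0 \<Longrightarrow> P (vec p n a) = vec 0 (n + nat p) a"
    using level_projection_exists by blast
  let ?U = "shift_by 1" and ?W = "vec 0 0"
  have Pb: "bounded_operator \<K> \<K> P" using P by (simp add: selfadjoint_projection_def)
  have Wb: "bounded_operator H \<K> ?W" using embedding_isometry by (simp add: isometry_operator_def)
  note Kh = K.complex_hilbert_space_axioms and Kip = K.complex_inner_product_space_axioms
  note Hh = complex_hilbert_space_axioms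
  have dil: "moment_dilation M H A \<K> ?U P ?W"
    unfolding moment_dilation_def
  proof (intro conjI allI ballI Kh shift_by_unitary P embedding_isometry)
    fix m n a assume a: "a \<in> hcarrier H"
    note d = dilation_inner[OF Hh Kh shift_by_bounded Pb Wb a]
    show "moment_kernel M H A m n a =
        hadjoint H \<K> ?W ((hadjoint \<K> \<K> ?U ^^ m) (P ((?U ^^ n) (?W a))))"
    proof (rule hinner_ext[OF moment_kernel_inner(1)[OF a] d(1)])
      fix z assume z: "z \<in> hcarrier H"
      show "hinner H z (moment_kernel M H A m n a) =
          hinner H z (hadjoint H \<K> ?W ((hadjoint \<K> \<K> ?U ^^ m) (P ((?U ^^ n) (?W a)))))"
        unfolding d(2)[OF z] moment_kernel_inner(2)[OF a z] unfolding power_vec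
        using z a by (simp add: P_vec inner_vec vec_carrier dilation_kernel_eq clip_id)
    qed
  qed
  let ?S = "{(?U ^^ k) (?W a) | k a. a \<in> hcarrier H}"
  have S: "K.span ?S \<subseteq> hcarrier \<K>"
    by (intro K.span_minimal K.subspace_carrier) (auto simp: power_vec vec_carrier)
  note PK = bounded_operatorD(1)[OF Pb] and UK = shift_by_carrier[of _ 1]
  \<comment> \<open>on the span, P y and P U y are sums of vectors of level 0 whose norms are the two quadratic
    forms that the kernel inequality compares\<close>
  have span_le: "hnorm \<K> (P (?U s)) \<le> hnorm \<K> (P s)" if s: "s \<in> K.span ?S" for s
  proof -
    obtain T r where T: "finite T" "T \<subseteq> ?S" and s_eq: "s = (\<Sum>t\<in>T. hscale \<K> (r t) t)"
      using s unfolding K.span_explicit by blast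
    have "\<forall>t\<in>T. \<exists>k a. a \<in> hcarrier H \<and> t = vec (int k) 0 a"
      using T(2) by (force simp: power_vec)
    then obtain k a where ka: "\<And>t. t \<in> T \<Longrightarrow> a t \<in> hcarrier H \<and> t = vec (int (k t)) 0 (a t)"
      by metis
    \<comment> \<open>the coefficients are moved into H, as the kernel inequality allows for no scalars\<close>
    define b where "b t = (if t \<in> T then hscale H (r t) (a t) else 0)" for t
    have b: "b t \<in> hcarrier H" for t using ka carrier_scale carrier_zero by (simp add: b_def)
    have "s = (\<Sum>t\<in>T. vec (int (k t)) 0 (b t))"
      unfolding s_eq using ka vec_scale by (intro sum.cong refl) (metis b_def)
    then have Ps: "P s = (\<Sum>t\<in>T. vec 0 (k t) (b t))"
      and PUs: "P (?U s) = (\<Sum>t\<in>T. vec 0 (Suc (k t)) (b t))"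
      by (simp_all add: bounded_operator_sum[OF Kip Kip Pb] bounded_operator_sum[OF Kip Kip shift_by_bounded]
          vec_carrier shift_by_vec P_vec nat_add_distrib)
    have sq: "(hnorm \<K> (\<Sum>t\<in>T. vec 0 (n t) (b t)))\<^sup>2 =
        Re (\<Sum>t\<in>T. \<Sum>u\<in>T. moment (n t) (n u) (b t) (b u))" for n
    proof -
      have "(\<Sum>t\<in>T. vec 0 (n t) (b t)) \<in> hcarrier \<K>" by (intro K.carrier_sum vec_carrier)
      moreover have "hinner \<K> (\<Sum>t\<in>T. vec 0 (n t) (b t)) (\<Sum>t\<in>T. vec 0 (n t) (b t)) =
          (\<Sum>t\<in>T. \<Sum>u\<in>T. hinner \<K> (vec 0 (n t) (b t)) (vec 0 (n u) (b u)))"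
        by (intro K.hinner_sum_sum vec_carrier)
      ultimately show ?thesis by (simp only: K.hnorm_power2 inner_vec_level_zero[OF b b])
    qed
    have "(hnorm \<K> (P (?U s)))\<^sup>2 \<le> (hnorm \<K> (P s))\<^sup>2"
      unfolding Ps PUs sq using T(1) b by (rule moment_shift_le)
    moreover have "s \<in> hcarrier \<K>" using S s by blast
    ultimately show ?thesis by (rule power2_le_imp_le[OF _ K.hnorm_nonneg[OF PK]])
  qed
  have le: "hnorm \<K> (P (?U y)) \<le> hnorm \<K> (P y)" and yK: "y \<in> hcarrier \<K>"
    if "y \<in> orbit_span H \<K> ?U ?W" for y
  proof -
    note closure = K.closure_of_sequence[OF that[unfolded orbit_span_def] S]
    then have y: "y \<in> hcarrier \<K>" by blast
    obtain \<sigma> where \<sigma>: "\<And>n. \<sigma> n \<in> K.span ?S" and lim: "(\<lambda>n. hnorm \<K> (\<sigma> n - y)) \<longlonglongrightarrow> 0"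
      using closure(2) by blast
    show "y \<in> hcarrier \<K>" by (rule y)
    have \<sigma>K: "\<sigma> n \<in> hcarrier \<K>" for n using \<sigma> S by blast
    note cont = K.bounded_operator_tendsto[OF Kip]
    have limP: "(\<lambda>n. hnorm \<K> (P (\<sigma> n))) \<longlonglongrightarrow> hnorm \<K> (P y)"
      by (rule K.tendsto_hnorm[OF PK[OF \<sigma>K] PK[OF y] cont[OF Pb \<sigma>K y lim]])
    have limPU: "(\<lambda>n. hnorm \<K> (P (?U (\<sigma> n)))) \<longlonglongrightarrow> hnorm \<K> (P (?U y))"
      by (rule K.tendsto_hnorm[OF PK[OF UK[OF \<sigma>K]] PK[OF UK[OF y]]
            cont[OF Pb UK[OF \<sigma>K] UK[OF y] cont[OF shift_by_bounded \<sigma>K y lim]]])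
    show "hnorm \<K> (P (?U y)) \<le> hnorm \<K> (P y)"
      using LIMSEQ_le[OF limPU limP] span_le[OF \<sigma>] by blast
  qed
  have "operator_le_on \<K> (orbit_span H \<K> ?U ?W) (\<lambda>y. hadjoint \<K> \<K> ?U (P (?U y))) P"
    unfolding operator_le_on_def
  proof
    fix y assume y: "y \<in> orbit_span H \<K> ?U ?W"
    have "hinner \<K> y (hadjoint \<K> \<K> ?U (P (?U y))) = of_real ((hnorm \<K> (P (?U y)))\<^sup>2)"
      using hadjoint_exists(2)[OF Kh Kip shift_by_bounded PK[OF UK[OF yK[OF y]]] yK[OF y]]
        selfadjoint_projection_inner[OF Kh P UK[OF yK[OF y]]] by simp
    moreover have "hinner \<K> y (P y) = of_real ((hnorm \<K> (P y))\<^sup>2)"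
      by (rule selfadjoint_projection_inner[OF Kh P yK[OF y]])
    moreover have "(hnorm \<K> (P (?U y)))\<^sup>2 \<le> (hnorm \<K> (P y))\<^sup>2"
      using le[OF y] K.hnorm_nonneg[OF PK[OF UK[OF yK[OF y]]]] by (intro power_mono)
    ultimately show "hinner \<K> y (hadjoint \<K> \<K> ?U (P (?U y))) \<le> hinner \<K> y (P y)"
      by (simp add: less_eq_complex_def del: of_real_power)
  qed
  with dil show ?thesis by blast
qed

end

section \<open>The equivalence\<close>

theorem theorem8:
  fixes M :: "'w::topological_space measure"
    and H :: "'h::ab_group_add hilbert"
    and A :: "'w \<Rightarrow> 'h \<Rightarrow> 'h"
  assumes "borel_prob_space M"
    and "complex_hilbert_space H"
    and "random_operator M H A"
    and "moments_exist M H A"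
  shows
    "((\<exists>(K :: 'h dilation_vec hilbert) U P W.
         moment_dilation M H A K U P W \<and>
         operator_le_on K (orbit_span H K U W) (\<lambda>y. hadjoint K K U (P (U y))) P)
      \<longleftrightarrow> kernel_le H (shift_kernel (moment_kernel M H A)) (moment_kernel M H A)) \<and>
     ((\<exists>(K :: 'k::ab_group_add hilbert) U P W.
         moment_dilation M H A K U P W \<and>
         operator_le_on K (orbit_span H K U W) (\<lambda>y. hadjoint K K U (P (U y))) P)
      \<longrightarrow> kernel_le H (shift_kernel (moment_kernel M H A)) (moment_kernel M H A)) \<and>
     (kernel_le H (shift_kernel (moment_kernel M H A)) (moment_kernel M H A) \<longrightarrow>
       (\<exists>(K :: 'h dilation_vec hilbert) U P W.
         moment_dilation M H A K U P W \<and>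
         operator_le_on K (orbit_span H K U W) (\<lambda>y. hadjoint K K U (P (U y))) P))"
proof -
  have "random_operator_with_moments H M A"
    using assms by (simp add: random_operator_with_moments_def random_operator_with_moments_axioms_def
        borel_prob_space_def)
  then have "\<exists>(K :: 'h dilation_vec hilbert) U P W. moment_dilation M H A K U P W \<and>
      operator_le_on K (orbit_span H K U W) (\<lambda>y. hadjoint K K U (P (U y))) P"
    if "kernel_le H (shift_kernel (moment_kernel M H A)) (moment_kernel M H A)"
    using that by (intro shift_contractive.constrained_dilation_exists shift_contractive.intro
        shift_contractive_axioms.intro)
  then show ?thesis
    by (intro conjI iffI impI; (elim exE conjE)?) (rule dilation_imp_kernel_le[OF assms(2)], assumption+)+
qed

end
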